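(* For every $\psi\in\mathcal{M}$ there is exactly one Borel probability measure $\mu$ on $\Omega^*$ such that $\psi(f)=\int_{\Omega^*}\psi_\omega(f)\,d\mu(\omega)$ for every $f\in L^\infty([1,\infty))$.
   Context: $L^\infty([1,\infty))$ is the space of real essentially bounded measurable functions on $[1,\infty)$. $\mathcal{M}$ is the set of linear functionals $\psi$ on $L^\infty([1,\infty))$ with $\psi(f)\le\limsup_{x\to\infty}\frac1x\int_1^xf(t)\,dt$ for all $f$. $\eta\text{-}\lim_n a_n$ is the limit of a bounded sequence along an ultrafilter $\eta$ on $\mathbb{N}$. $\mathbb{N}^*$ is the set of free ultrafilters on $\mathbb{N}$ (remainder of $\beta\mathbb{N}$), $\tau$ the continuous extension to $\beta\mathbb{N}$ of $n\mapsto n+1$. $\Omega$ is the quotient of $\beta\mathbb{N}\times[0,1]$ identifying $(\eta,1)$ with $(\tau\eta,0)$, and $\Omega^*$ the closed subspace of classes $(\eta,t)$ with $\eta\in\mathbb{N}^*$. For $\omega=(\eta,t)\in\Omega^*$, $\theta=2^t$, $\psi_\omega(f)=\eta\text{-}\lim_n\frac{1}{\theta2^n}\int_1^{\theta2^n}f(y)\,dy$.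
   Formalization: "Borel probability measure" is taken to mean regular Borel probability measure: the measure found is regular and is unique among regular ones; uniqueness among all Borel probability measures on the non-metrizable compact space Ω* is false. *)

theory Defs
  imports "HOL-Analysis.Analysis" "HOL-Probability.Probability_Measure"
begin

section \<open>The space of essentially bounded functions on the half-line from 1\<close>

definition ess_bounded :: "(real \<Rightarrow> real) \<Rightarrow> bool" where
  "ess_bounded f \<longleftrightarrow>
     f \<in> borel_measurable (lebesgue_on {1..}) \<and> (\<exists>C. AE x in lebesgue_on {1..}. \<bar>f x\<bar> \<le> C)"

definition Linf_rel :: "(real \<Rightarrow> real) \<Rightarrow> (real \<Rightarrow> real) \<Rightarrow> bool" where
  "Linf_rel f g \<longleftrightarrow> ess_bounded f \<and> ess_bounded g \<and> (AE x in lebesgue_on {1..}. f x = g x)"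

lemma ess_bounded_zero: "ess_bounded (\<lambda>_. 0)"
  unfolding ess_bounded_def by auto

lemma ess_bounded_add:
  assumes "ess_bounded f" "ess_bounded g"
  shows "ess_bounded (\<lambda>x. f x + g x)"
proof -
  from assms obtain C D where
    C: "AE x in lebesgue_on {1..}. \<bar>f x\<bar> \<le> C" and D: "AE x in lebesgue_on {1..}. \<bar>g x\<bar> \<le> D"
    unfolding ess_bounded_def by auto
  have "AE x in lebesgue_on {1..}. \<bar>f x + g x\<bar> \<le> C + D"
    using C D by eventually_elim auto
  with assms show ?thesis
    unfolding ess_bounded_def by auto
qed

lemma ess_bounded_scale:
  assumes "ess_bounded f"
  shows "ess_bounded (\<lambda>x. c * f x)"
proof -
  from assms obtain C where C: "AE x in lebesgue_on {1..}. \<bar>f x\<bar> \<le> C"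
    unfolding ess_bounded_def by auto
  have "AE x in lebesgue_on {1..}. \<bar>c * f x\<bar> \<le> \<bar>c\<bar> * C"
    using C by eventually_elim (auto simp: abs_mult intro: mult_left_mono)
  with assms show ?thesis
    unfolding ess_bounded_def by auto
qed

quotient_type Linf = "real \<Rightarrow> real" / partial: Linf_rel
proof (rule part_equivpI)
  show "\<exists>f. Linf_rel f f"
    using ess_bounded_zero by (auto simp: Linf_rel_def)
  show "symp Linf_rel"
    by (rule sympI) (auto simp: Linf_rel_def elim: eventually_mono)
  show "transp Linf_rel"
    by (rule transpI) (auto simp: Linf_rel_def elim: eventually_elim2)
qed

instantiation Linf :: real_vector
begin

lift_definition zero_Linf :: Linf is "\<lambda>_. 0"
  by (auto simp: Linf_rel_def ess_bounded_zero)

lift_definition plus_Linf :: "Linf \<Rightarrow> Linf \<Rightarrow> Linf" is "\<lambda>f g x. f x + g x"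
  by (auto simp: Linf_rel_def ess_bounded_add elim: eventually_elim2)

lift_definition scaleR_Linf :: "real \<Rightarrow> Linf \<Rightarrow> Linf" is "\<lambda>c f x. c * f x"
  by (auto simp: Linf_rel_def ess_bounded_scale elim: eventually_mono)

definition uminus_Linf :: "Linf \<Rightarrow> Linf" where "uminus_Linf f = (-1) *\<^sub>R f"

definition minus_Linf :: "Linf \<Rightarrow> Linf \<Rightarrow> Linf" where "minus_Linf f g = f + (- g)"

instance
proof
  fix a b c :: Linf and r s :: real
  show "a + b + c = a + (b + c)"
    by transfer (auto simp: Linf_rel_def algebra_simps intro!: ess_bounded_add)
  show "a + b = b + a"
    by transfer (auto simp: Linf_rel_def algebra_simps intro!: ess_bounded_add)
  show "0 + a = a"
    by transfer (auto simp: Linf_rel_def)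
  show "- a + a = 0"
    unfolding uminus_Linf_def
    by transfer (auto simp: Linf_rel_def ess_bounded_zero)
  show "a - b = a + - b"
    by (rule minus_Linf_def)
  show "r *\<^sub>R (a + b) = r *\<^sub>R a + r *\<^sub>R b"
    by transfer (auto simp: Linf_rel_def distrib_left intro!: ess_bounded_add ess_bounded_scale)
  show "(r + s) *\<^sub>R a = r *\<^sub>R a + s *\<^sub>R a"
    by transfer (auto simp: Linf_rel_def distrib_right intro!: ess_bounded_add ess_bounded_scale)
  show "r *\<^sub>R s *\<^sub>R a = (r * s) *\<^sub>R a"
    by transfer (auto simp: Linf_rel_def mult.assoc intro!: ess_bounded_scale)
  show "1 *\<^sub>R a = a"
    by transfer (auto simp: Linf_rel_def)
qed

end

lift_definition mean :: "Linf \<Rightarrow> real \<Rightarrow> real" is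
  "\<lambda>f x. (1 / x) * (LINT t|lebesgue_on {1..x}. f t)"
proof (rule ext)
  fix f g :: "real \<Rightarrow> real" and x :: real
  assume fg: "Linf_rel f g"
  have meas: "h \<in> borel_measurable (lebesgue_on {1..x})" if "ess_bounded h" for h
    using that unfolding ess_bounded_def
    by (auto intro: measurable_restrict_mono[where A = "{1..}"])
  have "AE t in lebesgue. t \<in> {1..} \<longrightarrow> f t = g t"
    using fg by (simp add: Linf_rel_def AE_restrict_space_iff)
  then have "AE t in lebesgue_on {1..x}. f t = g t"
    by (auto simp: AE_restrict_space_iff elim: eventually_mono)
  then have "(LINT t|lebesgue_on {1..x}. f t) = (LINT t|lebesgue_on {1..x}. g t)"
    using fg meas by (intro integral_cong_AE) (auto simp: Linf_rel_def)
  then show "(1 / x) * (LINT t|lebesgue_on {1..x}. f t) = (1 / x) * (LINT t|lebesgue_on {1..x}. g t)"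
    by simp
qed

definition mean_functionals :: "(Linf \<Rightarrow> real) set" where
  "mean_functionals =
     {\<psi>. linear \<psi> \<and> (\<forall>f. ereal (\<psi> f) \<le> Limsup at_top (\<lambda>x. ereal (mean f x)))}"

section \<open>Ultrafilters on the natural numbers\<close>

typedef betaN = "{F :: nat filter. F \<noteq> bot \<and>
    (\<forall>P. eventually P F \<or> eventually (\<lambda>n. \<not> P n) F)}"
  morphisms filter_of betaN_of
proof
  show "principal {0 :: nat} \<in> {F. F \<noteq> bot \<and> (\<forall>P. eventually P F \<or> eventually (\<lambda>n. \<not> P n) F)}"
    by (auto simp: eventually_principal principal_eq_bot_iff)
qed

setup_lifting type_definition_betaN

text \<open>Stone topology: basic sets consist of the ultrafilters containing a given set.\<close>

instantiation betaN :: topological_space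
begin

definition open_betaN :: "betaN set \<Rightarrow> bool" where
  "open_betaN = generate_topology (range (\<lambda>A. {\<eta>. eventually (\<lambda>n. n \<in> A) (filter_of \<eta>)}))"

instance
  by standard (auto simp: open_betaN_def intro: generate_topology.intros)

end

lift_definition of_nat_betaN :: "nat \<Rightarrow> betaN" is "\<lambda>n. principal {n}"
  by (auto simp: eventually_principal principal_eq_bot_iff)

definition free_ultrafilters :: "betaN set" where
  "free_ultrafilters = {\<eta>. \<forall>A. eventually (\<lambda>n. n \<in> A) (filter_of \<eta>) \<longrightarrow> infinite A}"

lift_definition tau :: "betaN \<Rightarrow> betaN" is "filtermap Suc"
  by (auto simp: filtermap_bot_iff eventually_filtermap)

text \<open>\<open>tau\<close> continuously extends the successor:\<close>

lemma tau_of_nat: "tau (of_nat_betaN n) = of_nat_betaN (Suc n)"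
  by transfer (simp add: filtermap_principal)

lemma continuous_on_tau: "continuous_on UNIV tau"
proof (rule continuous_on_generate_topology[OF open_betaN_def])
  fix B :: "betaN set"
  assume "B \<in> range (\<lambda>A. {\<eta>. eventually (\<lambda>n. n \<in> A) (filter_of \<eta>)})"
  then obtain A where B: "B = {\<eta>. eventually (\<lambda>n. n \<in> A) (filter_of \<eta>)}"
    by auto
  let ?C = "{\<eta>. eventually (\<lambda>n. n \<in> Suc -` A) (filter_of \<eta>)}"
  have "open ?C"
    unfolding open_betaN_def by (rule generate_topology.Basis) blast
  moreover have "?C = tau -` B"
    by (auto simp: B tau.rep_eq eventually_filtermap)
  ultimately show "\<exists>C. open C \<and> C \<inter> UNIV = tau -` B \<inter> UNIV"
    by auto
qed

section \<open>The mapping torus of \<open>tau\<close>\<close>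

inductive glue :: "betaN \<times> real \<Rightarrow> betaN \<times> real \<Rightarrow> bool" where
  "glue (\<eta>, 1) (tau \<eta>, 0)"

abbreviation cylinder :: "(betaN \<times> real) set" where
  "cylinder \<equiv> UNIV \<times> {0..1}"

definition Omega_rel :: "betaN \<times> real \<Rightarrow> betaN \<times> real \<Rightarrow> bool" where
  "Omega_rel p q \<longleftrightarrow> p \<in> cylinder \<and> q \<in> cylinder \<and> equivclp glue p q"

quotient_type Omega = "betaN \<times> real" / partial: Omega_rel
proof (rule part_equivpI)
  show "\<exists>p. Omega_rel p p"
    by (rule exI[of _ "(undefined, 0)"]) (auto simp: Omega_rel_def)
  show "symp Omega_rel"
    by (rule sympI) (auto simp: Omega_rel_def intro: equivclp_sym)
  show "transp Omega_rel"
    by (rule transpI) (auto simp: Omega_rel_def intro: equivclp_trans)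
qed

instantiation Omega :: topological_space
begin

definition open_Omega :: "Omega set \<Rightarrow> bool" where
  "open_Omega U \<longleftrightarrow> openin (top_of_set cylinder) {p \<in> cylinder. abs_Omega p \<in> U}"

instance
proof
  show "open (UNIV :: Omega set)"
    by (simp add: open_Omega_def)
next
  fix S T :: "Omega set"
  assume "open S" "open T"
  moreover have "{p \<in> cylinder. abs_Omega p \<in> S \<inter> T} =
      {p \<in> cylinder. abs_Omega p \<in> S} \<inter> {p \<in> cylinder. abs_Omega p \<in> T}"
    by auto
  ultimately show "open (S \<inter> T)"
    unfolding open_Omega_def by (simp add: openin_Int)
next
  fix K :: "Omega set set"
  assume "\<forall>S\<in>K. open S"
  moreover have "{p \<in> cylinder. abs_Omega p \<in> \<Union>K} =
      \<Union>((\<lambda>S. {p \<in> cylinder. abs_Omega p \<in> S}) ` K)"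
    by auto
  ultimately show "open (\<Union>K)"
    unfolding open_Omega_def by (auto intro!: openin_Union simp del: Union_iff UN_simps)
qed

end

definition Omega_star :: "Omega set" where
  "Omega_star = abs_Omega ` (free_ultrafilters \<times> {0..1})"

lift_definition psi :: "Omega \<Rightarrow> Linf \<Rightarrow> real" is
  "\<lambda>(\<eta>, t) f. Lim (filter_of \<eta>) (\<lambda>n. mean f (2 powr t * 2 ^ n))"
proof -
  define R :: "betaN \<times> real \<Rightarrow> Linf \<Rightarrow> real"
    where "R = (\<lambda>(\<eta>, t) f. Lim (filter_of \<eta>) (\<lambda>n. mean f (2 powr t * 2 ^ n)))"
  have shift: "Lim (filtermap Suc F) g = Lim F (\<lambda>n. g (Suc n))" for F and g :: "nat \<Rightarrow> real"
    by (simp add: Topological_Spaces.Lim_def filterlim_filtermap)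
  have glue: "R p = R q" if "glue p q" for p q
    using that by cases (simp add: R_def fun_eq_iff shift tau.rep_eq)
  have "R p = R q" if "equivclp glue p q" for p q
    using that by (induction rule: equivclp_induct) (auto dest: glue)
  then show "(case p of (\<eta>, t) \<Rightarrow> \<lambda>f. Lim (filter_of \<eta>) (\<lambda>n. mean f (2 powr t * 2 ^ n))) =
      (case q of (\<eta>, t) \<Rightarrow> \<lambda>f. Lim (filter_of \<eta>) (\<lambda>n. mean f (2 powr t * 2 ^ n)))"
    if "Omega_rel p q" for p q
    using that unfolding Omega_rel_def R_def by blast
qed

text \<open>\<open>Omega_star\<close> is compact Hausdorff but not metrizable, and it carries Borel probability
  measures that are not regular.  As usual on such spaces, Borel measures are required to be regular.\<close>

definition regular_Borel_prob :: "'a::topological_space set \<Rightarrow> 'a measure \<Rightarrow> bool" where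
  "regular_Borel_prob X \<mu> \<longleftrightarrow>
     prob_space \<mu> \<and> space \<mu> = X \<and> sets \<mu> = sets (restrict_space borel X) \<and>
     (\<forall>B\<in>sets \<mu>.
        emeasure \<mu> B = (SUP K \<in> {K. K \<subseteq> B \<and> compact K}. emeasure \<mu> K) \<and>
        emeasure \<mu> B = (INF U \<in> {U. B \<subseteq> U \<and> openin (top_of_set X) U}. emeasure \<mu> U))"

end

theory Submission
  imports Defs
begin

text \<open>The functions \<open>\<omega> \<mapsto> psi \<omega> f\<close> on the compact space \<open>Omega_star\<close> form a vector lattice
  of continuous functions: the maximum of two means is again a mean, because the primitive of
  \<open>p * 1_{P > 0}\<close> is \<open>max 0 P\<close> whenever \<open>P\<close> is the primitive of \<open>p\<close>.  The lattice contains bump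
  functions subordinate to any open set, namely means of step functions whose primitives are tents
  placed at the points \<open>2 powr t * 2 ^ n\<close>, \<open>n \<in> A\<close>.  The limit superior of \<open>mean f\<close> is attained as
  some \<open>psi \<omega> f\<close>, so every mean functional is positive and normalised with respect to this lattice.
  The Riesz construction, which uses only a lattice with bump functions on a compact space, then
  gives the measure, and regularity gives its uniqueness.\<close>

section \<open>Riesz representation on a lattice of continuous functions\<close>

text \<open>The functions \<open>H f\<close> are not known to exhaust the continuous functions on
  \<open>X\<close>, and compact sets are not known to be Borel. The Riesz argument therefore stays
  inside the lattice, and bumps are matched to sets only up to an error \<epsilon>. What makes the
  lattice rich enough is that a mean varies slowly: its change from \<open>x\<close> to
  \<open>y\<close> is controlled by \<open>y / x - 1\<close>, so it is uniformly continuous in the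
  logarithm of \<open>x\<close>. Hence the coordinate \<open>x = 2 powr t * 2 ^ n\<close>: the
  integer part goes to an ultrafilter and the fractional part stays real, with \<open>t = 1\<close>
  over \<open>n\<close> meeting \<open>t = 0\<close> over \<open>n + 1\<close>. For the same reason
  the tents have width proportional to their position. Closure under maxima rests on one
  observation: on each component of the set where \<open>P\<close> is positive, \<open>P\<close>
  vanishes at both ends, so \<open>p\<close> integrates to \<open>0\<close> there.\<close>

locale function_lattice =
  fixes X :: "'a::topological_space set"
    and H :: "'b::real_vector \<Rightarrow> 'a \<Rightarrow> real"
    and e :: 'b
  assumes compact_space: "compact X"
    and H_add: "x \<in> X \<Longrightarrow> H (f + g) x = H f x + H g x"
    and H_scaleR: "x \<in> X \<Longrightarrow> H (c *\<^sub>R f) x = c * H f x"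
    and H_unit: "x \<in> X \<Longrightarrow> H e x = 1"
    and H_max: "\<exists>h. \<forall>x\<in>X. H h x = max (H f x) (H g x)"
    and H_continuous: "continuous_on X (H f)"
    and H_bump: "openin (top_of_set X) U \<Longrightarrow> x \<in> U \<Longrightarrow>
      \<exists>g. H g x = 1 \<and> (\<forall>y\<in>X. 0 \<le> H g y \<and> H g y \<le> 1) \<and> (\<forall>y\<in>X - U. H g y = 0)"
begin

lemma H_minus: "x \<in> X \<Longrightarrow> H (- f) x = - H f x"
  using H_scaleR[of x "-1" f] by simp

lemma H_diff: "x \<in> X \<Longrightarrow> H (f - g) x = H f x - H g x"
  using H_add[of x f "- g"] by (simp add: H_minus)

lemma H_zero: "x \<in> X \<Longrightarrow> H 0 x = 0"
  using H_scaleR[of x 0 e] by simp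

lemma H_sum: "x \<in> X \<Longrightarrow> H (\<Sum>i\<in>A. f i) x = (\<Sum>i\<in>A. H (f i) x)"
  by (induction A rule: infinite_finite_induct) (auto simp: H_zero H_add)

lemma H_min: "\<exists>h. \<forall>x\<in>X. H h x = min (H f x) (H g x)"
proof -
  obtain h where "\<forall>x\<in>X. H h x = max (H (- f) x) (H (- g) x)"
    using H_max by blast
  then have "\<forall>x\<in>X. H (- h) x = min (H f x) (H g x)"
    by (auto simp: H_minus)
  then show ?thesis ..
qed

text \<open>A weak form of the usual relation between a function and an open set: \<open>H g\<close>
  vanishes off \<open>U\<close>, but its support need not lie in \<open>U\<close>. Cutting at a
  level \<epsilon> later supplies the compact sets.\<close>

definition subordinate :: "'b \<Rightarrow> 'a set \<Rightarrow> bool" where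
  "subordinate g U \<longleftrightarrow> (\<forall>y\<in>X. 0 \<le> H g y \<and> H g y \<le> 1) \<and> (\<forall>y\<in>X - U. H g y = 0)"

lemma subordinate_zero: "subordinate 0 U"
  by (simp add: subordinate_def H_zero)

lemma subordinate_mono: "subordinate g U \<Longrightarrow> U \<subseteq> V \<Longrightarrow> subordinate g V"
  by (auto simp: subordinate_def)

lemma openin_superlevel: "openin (top_of_set X) {x \<in> X. c < H f x}"
proof -
  have "{x \<in> X. c < H f x} = X \<inter> H f -` {c<..}" by auto
  then show ?thesis
    using continuous_openin_preimage_gen[OF H_continuous[of f] open_greaterThan[of c]] by simp
qed

lemma openin_sublevel: "openin (top_of_set X) {x \<in> X. H f x < c}"
proof -
  have "{x \<in> X. H f x < c} = X \<inter> H f -` {..<c}" by auto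
  then show ?thesis
    using continuous_openin_preimage_gen[OF H_continuous[of f] open_lessThan[of c]] by simp
qed

lemma compact_superlevel: "compact {x \<in> X. c \<le> H f x}"
proof -
  have "{x \<in> X. c \<le> H f x} = X \<inter> H f -` {c..}" by auto
  then have "closedin (top_of_set X) {x \<in> X. c \<le> H f x}"
    using continuous_closedin_preimage[OF H_continuous[of f] closed_atLeast[of c]] by simp
  then show ?thesis
    by (rule closedin_compact[OF compact_space])
qed

lemma subordinate_finite_max:
  assumes "finite C" "\<And>c. c \<in> C \<Longrightarrow> subordinate (g c) U"
  shows "\<exists>G. subordinate G U \<and> (\<forall>c\<in>C. \<forall>y\<in>X. H (g c) y \<le> H G y)"
  using assms
proof (induction C)
  case empty
  then show ?case using subordinate_zero by blast
next
  case (insert c C)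
  then obtain G where G: "subordinate G U" "\<forall>c\<in>C. \<forall>y\<in>X. H (g c) y \<le> H G y"
    by blast
  obtain h where h: "\<forall>x\<in>X. H h x = max (H (g c) x) (H G x)"
    using H_max by blast
  have "subordinate h U"
    using h G(1) insert.prems[of c] by (auto simp: subordinate_def)
  moreover have "\<forall>c\<in>insert c C. \<forall>y\<in>X. H (g c) y \<le> H h y"
    using G(2) h by fastforce
  ultimately show ?case by blast
qed

text \<open>Stands in for a partition of unity. Near each point of \<open>K\<close> some bump
  exceeds \<open>1 - \<epsilon>\<close>, finitely many such neighbourhoods cover \<open>K\<close>,
  and a sum of nonnegative terms dominates each of them. Having one function per index lets the sum
  be compared with the contents of the \<open>U i\<close>.\<close>

lemma subordinate_cover:
  assumes K: "compact K" "K \<subseteq> X" "K \<subseteq> (\<Union>i\<in>S. U i)"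
    and U: "\<And>i. i \<in> S \<Longrightarrow> openin (top_of_set X) (U i)"
    and "0 < \<epsilon>"
  shows "\<exists>I G. finite I \<and> I \<subseteq> S \<and> (\<forall>i\<in>I. subordinate (G i) (U i)) \<and>
    (\<forall>x\<in>K. 1 - \<epsilon> < (\<Sum>i\<in>I. H (G i) x))"
proof -
  have "\<exists>i g T. i \<in> S \<and> subordinate g (U i) \<and> open T \<and> x \<in> T \<and> (\<forall>y\<in>X \<inter> T. 1 - \<epsilon> < H g y)"
    if xK: "x \<in> K" for x
  proof -
    obtain i where i: "i \<in> S" "x \<in> U i" using K xK by blast
    obtain g where g: "H g x = 1" "subordinate g (U i)"
      using H_bump[OF U[OF i(1)] i(2)] by (auto simp: subordinate_def)
    obtain T where "open T" "{y \<in> X. 1 - \<epsilon> < H g y} = X \<inter> T"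
      using openin_superlevel unfolding openin_open by blast
    then show ?thesis
      using i g \<open>0 < \<epsilon>\<close> that K(2) by (intro exI[of _ i] exI[of _ g] exI[of _ T]) auto
  qed
  then obtain ix g T where *: "\<And>x. x \<in> K \<Longrightarrow> ix x \<in> S \<and> subordinate (g x) (U (ix x)) \<and> open (T x) \<and>
      x \<in> T x \<and> (\<forall>y\<in>X \<inter> T x. 1 - \<epsilon> < H (g x) y)"
    by metis
  then have ix: "\<And>x. x \<in> K \<Longrightarrow> ix x \<in> S"
    and g: "\<And>x. x \<in> K \<Longrightarrow> subordinate (g x) (U (ix x))"
    and T: "\<And>x. x \<in> K \<Longrightarrow> open (T x)" "\<And>x. x \<in> K \<Longrightarrow> x \<in> T x"
      "\<And>x y. x \<in> K \<Longrightarrow> y \<in> X \<Longrightarrow> y \<in> T x \<Longrightarrow> 1 - \<epsilon> < H (g x) y"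
    by auto
  obtain C where C: "C \<subseteq> K" "finite C" "K \<subseteq> (\<Union>c\<in>C. T c)"
    using compactE_image[OF K(1), of K T] T by (metis UN_I subsetI)
  \<comment> \<open>Several points may choose the same index. The maximum of their bumps merges them
    and stays bounded by \<open>1\<close>, which a sum would not.\<close>
  have "\<exists>G. subordinate G (U i) \<and> (\<forall>c\<in>{c\<in>C. ix c = i}. \<forall>y\<in>X. H (g c) y \<le> H G y)" for i
    using C g by (intro subordinate_finite_max) auto
  then obtain G where G: "\<And>i. subordinate (G i) (U i)"
    "\<And>i c y. c \<in> C \<Longrightarrow> ix c = i \<Longrightarrow> y \<in> X \<Longrightarrow> H (g c) y \<le> H (G i) y"
    by (metis (mono_tags, lifting) mem_Collect_eq)
  show ?thesis
  proof (intro exI[of _ "ix ` C"] exI[of _ G] conjI ballI)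
    show "finite (ix ` C)" "ix ` C \<subseteq> S" using C ix by auto
    show "subordinate (G i) (U i)" for i by (rule G)
    fix x assume x: "x \<in> K"
    then obtain c where c: "c \<in> C" "x \<in> T c" using C by blast
    have "1 - \<epsilon> < H (g c) x" using T(3) c C x K by blast
    also have "\<dots> \<le> H (G (ix c)) x" using G(2) c x K by blast
    also have "\<dots> \<le> (\<Sum>i\<in>ix ` C. H (G i) x)"
      using G(1) x K C c by (intro member_le_sum) (auto simp: subordinate_def)
    finally show "1 - \<epsilon> < (\<Sum>i\<in>ix ` C. H (G i) x)" .
  qed
qed

text \<open>The substitute for Urysohn's lemma, up to \<epsilon>: the cover lemma with a one-element
  index set.\<close>

lemma subordinate_compact:
  assumes "compact K" "K \<subseteq> U" "openin (top_of_set X) U" "0 < \<epsilon>"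
  shows "\<exists>g. subordinate g U \<and> (\<forall>x\<in>K. 1 - \<epsilon> < H g x)"
proof -
  have "U \<subseteq> X" using assms openin_imp_subset by blast
  then have "K \<subseteq> X" using assms by blast
  then obtain I G where I: "finite I" "I \<subseteq> {()}" "\<forall>i\<in>I. subordinate (G i) U"
    "\<forall>x\<in>K. 1 - \<epsilon> < (\<Sum>i\<in>I. H (G i) x)"
    using subordinate_cover[where S="{()}" and U="\<lambda>_. U", of K \<epsilon>] assms by auto
  have "subordinate (\<Sum>i\<in>I. G i) U"
    using I subordinate_zero by (cases "I = {}") (auto simp: subset_singleton_iff)
  then show ?thesis
    using I \<open>U \<subseteq> X\<close> assms(2) by (metis H_sum subsetD)
qed

section \<open>Uniqueness of the representing measure\<close>

lemma H_measurable: "H f \<in> borel_measurable (restrict_space borel X)"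
  by (intro borel_measurable_continuous_on_restrict H_continuous)

lemma openin_sets: "openin (top_of_set X) U \<Longrightarrow> U \<in> sets (restrict_space borel X)"
  by (auto simp: openin_open sets_restrict_space)

lemma H_bounded: "\<exists>B>0. \<forall>x\<in>X. \<bar>H f x\<bar> \<le> B"
proof -
  have "bounded (H f ` X)"
    by (intro compact_imp_bounded compact_continuous_image H_continuous compact_space)
  then show ?thesis
    unfolding bounded_pos by auto
qed

lemma H_integrable:
  assumes "regular_Borel_prob X \<mu>"
  shows "integrable \<mu> (H f)"
proof -
  interpret prob_space \<mu> using assms by (simp add: regular_Borel_prob_def)
  have [measurable_cong]: "sets \<mu> = sets (restrict_space borel X)" and "space \<mu> = X"
    using assms by (auto simp: regular_Borel_prob_def)
  moreover obtain B where "\<forall>x\<in>X. \<bar>H f x\<bar> \<le> B" using H_bounded by blast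
  moreover have "H f \<in> borel_measurable \<mu>"
    using H_measurable by measurable
  ultimately show ?thesis
    by (intro integrable_const_bound[of _ B]) auto
qed

lemma regular_Borel_prob_outer:
  assumes "regular_Borel_prob X \<mu>" "A \<in> sets \<mu>"
  shows "emeasure \<mu> A = (INF U \<in> {U. A \<subseteq> U \<and> openin (top_of_set X) U}. emeasure \<mu> U)"
  using assms unfolding regular_Borel_prob_def by blast

text \<open>Inner regularity of \<mu> reduces the claim to a compact \<open>K\<close> inside
  \<open>U\<close>. There \<open>indicator K - \<epsilon> \<le> H g \<le> indicator U\<close>
  pointwise for a suitable \<open>g\<close>, and the two integrals of \<open>H g\<close>
  agree.\<close>

lemma regular_measure_le:
  assumes \<mu>: "regular_Borel_prob X \<mu>" and \<nu>: "regular_Borel_prob X \<nu>"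
    and eq: "\<And>f. (LINT x|\<mu>. H f x) = (LINT x|\<nu>. H f x)"
    and U: "openin (top_of_set X) U"
  shows "emeasure \<mu> U \<le> emeasure \<nu> U"
proof -
  interpret M: prob_space \<mu> using \<mu> by (simp add: regular_Borel_prob_def)
  interpret N: prob_space \<nu> using \<nu> by (simp add: regular_Borel_prob_def)
  have sets: "sets \<mu> = sets (restrict_space borel X)" "sets \<nu> = sets (restrict_space borel X)"
    and space: "space \<mu> = X" "space \<nu> = X"
    using \<mu> \<nu> by (auto simp: regular_Borel_prob_def)
  have Um: "U \<in> sets \<mu>" "U \<in> sets \<nu>" using openin_sets[OF U] sets by auto
  have "emeasure \<mu> K \<le> emeasure \<nu> U" if K: "K \<subseteq> U" "compact K" for K
  \<comment> \<open>A compact \<open>K\<close> that is not measurable has \<open>emeasure\<close> 0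
    by convention.\<close>
  proof (cases "K \<in> sets \<mu>")
    case True
    have "M.prob K \<le> N.prob U"
    proof (rule field_le_epsilon)
      fix \<epsilon> :: real assume "0 < \<epsilon>"
      then obtain g where g: "subordinate g U" "\<forall>x\<in>K. 1 - \<epsilon> < H g x"
        using subordinate_compact[OF K(2,1) U] by blast
      have "U \<subseteq> X" using U openin_imp_subset by blast
      have int: "integrable \<mu> (\<lambda>x. indicator K x - \<epsilon>)" "integrable \<nu> (indicator U :: 'a \<Rightarrow> real)"
        using True Um by (auto simp: M.emeasure_eq_measure N.emeasure_eq_measure)
      have "M.prob K - \<epsilon> \<le> (LINT x|\<mu>. indicator K x - \<epsilon>)"
        using True by (simp add: M.prob_space M.emeasure_eq_measure)
      also have "\<dots> \<le> (LINT x|\<mu>. H g x)"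
        using g K \<open>U \<subseteq> X\<close> \<open>0 < \<epsilon>\<close> True
        by (intro integral_mono H_integrable \<mu> int)
           (auto simp: space subordinate_def indicator_def
             intro: less_imp_le order_trans[of _ 0])
      also have "\<dots> = (LINT x|\<nu>. H g x)" by (rule eq)
      also have "\<dots> \<le> (LINT x|\<nu>. indicator U x)"
        using g by (intro integral_mono H_integrable \<nu> int)
          (auto simp: space subordinate_def indicator_def)
      also have "\<dots> = N.prob U" using Um by (simp add: N.emeasure_eq_measure)
      finally show "M.prob K \<le> N.prob U + \<epsilon>" by simp
    qed
    then show ?thesis by (simp add: M.emeasure_eq_measure N.emeasure_eq_measure)
  qed (simp add: emeasure_notin_sets)
  then show ?thesis
    using \<mu> Um by (auto simp: regular_Borel_prob_def intro!: SUP_least)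
qed

text \<open>On open sets the preceding lemma applies in both directions; outer regularity carries
  the equality to all Borel sets.\<close>

lemma regular_measure_unique:
  assumes \<mu>: "regular_Borel_prob X \<mu>" and \<nu>: "regular_Borel_prob X \<nu>"
    and eq: "\<And>f. (LINT x|\<mu>. H f x) = (LINT x|\<nu>. H f x)"
  shows "\<mu> = \<nu>"
proof (rule measure_eqI)
  show sets: "sets \<mu> = sets \<nu>" using \<mu> \<nu> by (auto simp: regular_Borel_prob_def)
  have U: "emeasure \<mu> U = emeasure \<nu> U" if "openin (top_of_set X) U" for U
    using regular_measure_le[OF \<mu> \<nu> eq that] regular_measure_le[OF \<nu> \<mu> eq[symmetric] that]
    by (rule antisym)
  fix A assume A: "A \<in> sets \<mu>"
  then have "emeasure \<mu> A = (INF U \<in> {U. A \<subseteq> U \<and> openin (top_of_set X) U}. emeasure \<mu> U)"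
    by (rule regular_Borel_prob_outer[OF \<mu>])
  also have "\<dots> = (INF U \<in> {U. A \<subseteq> U \<and> openin (top_of_set X) U}. emeasure \<nu> U)"
    using U by (intro INF_cong) auto
  also have "\<dots> = emeasure \<nu> A"
    using A unfolding sets by (rule regular_Borel_prob_outer[OF \<nu>, symmetric])
  finally show "emeasure \<mu> A = emeasure \<nu> A" .
qed

end

text \<open>The \<open>k\<close>-th term is the part of the height \<open>y\<close> between the
  levels \<open>k / n\<close> and \<open>(k + 1) / n\<close>.\<close>

lemma sum_slices:
  fixes y :: real and m n :: nat
  assumes "0 \<le> y" "n > 0"
  shows "(\<Sum>k<m. min (max (y - k / n) 0) (1 / n)) = min y (m / n)"
proof (induction m)
  case 0
  then show ?case using assms by simp
next
  case (Suc m)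
  define d where "d = 1 / real n"
  have d: "0 < d" "real (Suc m) / n = m / n + d" using assms by (simp_all add: d_def add_divide_distrib)
  have "(\<Sum>k<Suc m. min (max (y - k / n) 0) (1 / n)) = min y (m / n) + min (max (y - m / n) 0) d"
    using Suc by (simp add: d_def)
  also have "\<dots> = min y (m / n + d)" using d(1) by linarith
  finally show ?case by (simp only: d(2))
qed

text \<open>The bound \<open>m / n\<close> drives the induction: if the next level
  \<open>m / n\<close> is still below \<open>y\<close>, then \<open>m / n + 1 / n\<close> is below
  \<open>y + 1 / n\<close>.\<close>

lemma sum_steps_le:
  fixes y :: real and m n :: nat
  assumes "0 \<le> y" "n > 0"
  shows "(\<Sum>k<m. if k / n < y then 1 / n else 0) \<le> min (m / n) (y + 1 / n)"
proof (induction m)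
  case 0
  then show ?case using assms by simp
next
  case (Suc m)
  have "real (Suc m) / n = m / n + 1 / n" "0 \<le> 1 / real n" by (simp_all add: add_divide_distrib)
  then show ?case using Suc by auto
qed

locale positive_functional = function_lattice +
  fixes J :: "'b \<Rightarrow> real"
  assumes linear_J: "linear J"
    and J_nonneg: "(\<And>x. x \<in> X \<Longrightarrow> 0 \<le> H f x) \<Longrightarrow> 0 \<le> J f"
    and J_unit: "J e = 1"
begin

lemma J_mono: "(\<And>x. x \<in> X \<Longrightarrow> H f x \<le> H g x) \<Longrightarrow> J f \<le> J g"
  using J_nonneg[of "g - f"] by (simp add: H_diff linear_diff[OF linear_J])

text \<open>\<open>J\<close> is given on the index type; positivity makes it a functional of the
  function \<open>H f\<close>.\<close>

lemma J_cong: "(\<And>x. x \<in> X \<Longrightarrow> H f x = H g x) \<Longrightarrow> J f = J g"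
  by (simp add: J_mono antisym)

lemma J_subordinate_nonneg: "subordinate g U \<Longrightarrow> 0 \<le> J g"
  by (rule J_nonneg) (simp add: subordinate_def)

section \<open>The content of open sets\<close>

definition content :: "'a set \<Rightarrow> ennreal" where
  "content U = (SUP g \<in> {g. subordinate g U}. ennreal (J g))"

lemma content_upper: "subordinate g U \<Longrightarrow> ennreal (J g) \<le> content U"
  unfolding content_def by (rule SUP_upper) simp

lemma content_mono: "U \<subseteq> V \<Longrightarrow> content U \<le> content V"
  unfolding content_def by (rule SUP_subset_mono) (auto intro: subordinate_mono)

lemma content_empty: "content {} = 0"
proof -
  have "J g = 0" if "subordinate g {}" for g
    using J_cong[of g 0] that linear_0[OF linear_J] by (simp add: subordinate_def H_zero)
  then have "content {} \<le> 0"
    unfolding content_def by (intro SUP_least) simp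
  then show ?thesis by simp
qed

lemma content_space: "content X = 1"
proof (rule antisym)
  have "J g \<le> 1" if "subordinate g X" for g
    using J_mono[of g e] that by (simp add: subordinate_def H_unit J_unit)
  then show "content X \<le> 1"
    unfolding content_def by (intro SUP_least) (simp add: ennreal_le_1)
  show "1 \<le> content X"
    using content_upper[of e X] by (simp add: subordinate_def H_unit J_unit)
qed

text \<open>On the compact set where \<open>H g\<close> is at least \<epsilon>, the cover lemma
  gives functions \<open>G i\<close> with sum above \<open>1 - \<epsilon>\<close>; elsewhere
  \<open>H g\<close> is below \<epsilon>. Hence
  \<open>H g x \<le> \<epsilon> + (\<Sum>i\<in>I. H (G i) x)\<close> on all of \<open>X\<close>, and
  \<open>J\<close> is monotone.\<close>

lemma content_countably_subadditive:
  fixes U :: "nat \<Rightarrow> 'a set"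
  assumes U: "\<And>i. openin (top_of_set X) (U i)"
  shows "content (\<Union>i. U i) \<le> (\<Sum>i. content (U i))"
  unfolding content_def[of "\<Union>i. U i"]
proof (rule SUP_least, rule ennreal_le_epsilon)
  fix g and \<epsilon> :: real assume "g \<in> {g. subordinate g (\<Union>i. U i)}" and \<epsilon>: "0 < \<epsilon>"
  then have g: "subordinate g (\<Union>i. U i)" by simp
  define K where "K = {x \<in> X. \<epsilon> \<le> H g x}"
  have "K \<subseteq> (\<Union>i\<in>UNIV. U i)"
    using g \<epsilon> unfolding K_def subordinate_def by force
  moreover have "compact K" "K \<subseteq> X" unfolding K_def by (auto intro: compact_superlevel)
  ultimately obtain I G where I: "finite I" "\<forall>i\<in>I. subordinate (G i) (U i)"
    "\<forall>x\<in>K. 1 - \<epsilon> < (\<Sum>i\<in>I. H (G i) x)"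
    using subordinate_cover[where S = UNIV and U = U, of K \<epsilon>] U \<epsilon> by auto
  have "J g \<le> J (\<epsilon> *\<^sub>R e + (\<Sum>i\<in>I. G i))"
  proof (rule J_mono)
    fix x assume x: "x \<in> X"
    have "0 \<le> (\<Sum>i\<in>I. H (G i) x)"
      using I x by (intro sum_nonneg) (auto simp: subordinate_def)
    moreover have "H g x \<le> 1" using g x by (auto simp: subordinate_def)
    ultimately have "H g x \<le> \<epsilon> + (\<Sum>i\<in>I. H (G i) x)"
      using I(3) x unfolding K_def by (cases "\<epsilon> \<le> H g x") force+
    then show "H g x \<le> H (\<epsilon> *\<^sub>R e + (\<Sum>i\<in>I. G i)) x"
      using x by (simp add: H_add H_scaleR H_unit H_sum)
  qed
  also have "\<dots> = \<epsilon> + (\<Sum>i\<in>I. J (G i))"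
    by (simp add: linear_add[OF linear_J] linear_scale[OF linear_J] linear_sum[OF linear_J] J_unit)
  finally have J_le: "J g \<le> \<epsilon> + (\<Sum>i\<in>I. J (G i))" .
  have nonneg: "0 \<le> J (G i)" if "i \<in> I" for i
    using I that J_subordinate_nonneg by blast
  from J_le have "ennreal (J g) \<le> ennreal (\<epsilon> + (\<Sum>i\<in>I. J (G i)))"
    by (rule ennreal_leI)
  also have "\<dots> = (\<Sum>i\<in>I. ennreal (J (G i))) + \<epsilon>"
    using nonneg \<epsilon> by (simp add: sum_nonneg add.commute)
  also have "(\<Sum>i\<in>I. ennreal (J (G i))) \<le> (\<Sum>i\<in>I. content (U i))"
    using I by (intro sum_mono content_upper) auto
  also have "\<dots> \<le> (\<Sum>i. content (U i))"
    using I by (intro sum_le_suminf) auto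
  finally show "ennreal (J g) \<le> (\<Sum>i. content (U i)) + ennreal \<epsilon>"
    by (simp add: add_right_mono)
qed

section \<open>The outer measure and measurability of open sets\<close>

definition outer :: "'a set \<Rightarrow> ennreal" where
  "outer A = (INF U \<in> {U. A \<subseteq> U \<and> openin (top_of_set X) U}. content U)"

lemma outer_open: "openin (top_of_set X) U \<Longrightarrow> outer U = content U"
  unfolding outer_def by (rule antisym) (auto intro: INF_lower INF_greatest content_mono)

lemma outer_mono: "A \<subseteq> B \<Longrightarrow> outer A \<le> outer B"
  unfolding outer_def by (rule INF_superset_mono) auto

lemma outer_le_1: "A \<subseteq> X \<Longrightarrow> outer A \<le> 1"
  using outer_mono[of A X] by (simp add: outer_open content_space)

lemma outer_approx:
  assumes "A \<subseteq> X" "0 < \<epsilon>"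
  obtains U where "A \<subseteq> U" "openin (top_of_set X) U" "content U \<le> outer A + ennreal \<epsilon>"
proof -
  have "outer A < top" using outer_le_1[OF assms(1)] by (rule le_less_trans) simp
  then have "outer A < outer A + ennreal \<epsilon>" using assms by simp
  then show ?thesis
    using that unfolding outer_def INF_less_iff by (auto intro: less_imp_le)
qed

lemma outer_countably_subadditive: "countably_subadditive (Pow X) outer"
proof (simp add: countably_subadditive_def, safe)
  fix A :: "nat \<Rightarrow> _" assume A: "range A \<subseteq> Pow X"
  show "outer (\<Union>i. A i) \<le> (\<Sum>n. outer (A n))"
  proof (rule ennreal_le_epsilon)
    fix \<epsilon> :: real assume \<epsilon>: "0 < \<epsilon>"
    have "\<exists>U. A n \<subseteq> U \<and> openin (top_of_set X) U \<and>
        content U \<le> outer (A n) + ennreal (\<epsilon> * (1/2)^Suc n)" for n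
    proof -
      have "A n \<subseteq> X" "0 < \<epsilon> * (1/2)^Suc n" using A \<epsilon> by auto
      from outer_approx[OF this] show ?thesis by metis
    qed
    then obtain U where U: "\<And>n. A n \<subseteq> U n" "\<And>n. openin (top_of_set X) (U n)"
      "\<And>n. content (U n) \<le> outer (A n) + ennreal (\<epsilon> * (1/2)^Suc n)"
      by metis
    have "outer (\<Union>i. A i) \<le> outer (\<Union>i. U i)"
      using U by (intro outer_mono) blast
    also have "\<dots> = content (\<Union>i. U i)"
      using U by (intro outer_open) auto
    also have "\<dots> \<le> (\<Sum>i. content (U i))"
      using U by (intro content_countably_subadditive)
    also have "\<dots> \<le> (\<Sum>n. outer (A n) + ennreal (\<epsilon> * (1/2) ^ Suc n))"
      using U(3) by (intro suminf_le) auto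
    also have "... = (\<Sum>n. outer (A n)) + (\<Sum>n. ennreal \<epsilon> * ennreal ((1/2) ^ Suc n))"
      using \<open>0 < \<epsilon>\<close> by (subst suminf_add[symmetric])
        (auto simp del: ennreal_suminf_cmult simp add: ennreal_mult[symmetric])
    also have "\<dots> = (\<Sum>n. outer (A n)) + \<epsilon>"
      unfolding ennreal_suminf_cmult
      by (subst suminf_ennreal_eq[OF zero_le_power power_half_series]) auto
    finally show "outer (\<Union>i. A i) \<le> (\<Sum>n. outer (A n)) + ennreal \<epsilon>" .
  qed
qed

lemma outer_measure_space_outer: "outer_measure_space (Pow X) outer"
  unfolding outer_measure_space_def
  using outer_countably_subadditive outer_open[of "{}"]
  by (auto simp: positive_def increasing_def content_empty intro: outer_mono)

text \<open>If \<open>f\<close> is subordinate to \<open>V \<inter> U\<close>, then \<open>V - U\<close> lies in the open set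
  \<open>W = {x \<in> V. H f x < \<epsilon>}\<close>, and \<open>H f + H g \<le> 1 + \<epsilon>\<close> for every \<open>g\<close> subordinate to \<open>W\<close>.\<close>

lemma content_split:
  assumes V: "openin (top_of_set X) V" and f: "subordinate f (V \<inter> U)"
  shows "ennreal (J f) + outer (V - U) \<le> content V"
proof (rule ennreal_le_epsilon)
  fix \<epsilon> :: real assume \<epsilon>: "0 < \<epsilon>"
  have "V \<subseteq> X" using V openin_imp_subset by blast
  define W where "W = V \<inter> {x \<in> X. H f x < \<epsilon>}"
  have W: "openin (top_of_set X) W"
    unfolding W_def by (intro openin_Int V openin_sublevel)
  have "V - U \<subseteq> W" using f \<open>V \<subseteq> X\<close> \<epsilon> by (auto simp: W_def subordinate_def)
  then have "outer (V - U) \<le> content W"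
    using W unfolding outer_def by (intro INF_lower) auto
  then have "ennreal (J f) + outer (V - U) \<le> ennreal (J f) + content W"
    by (rule add_left_mono)
  also have "\<dots> = (SUP g \<in> {g. subordinate g W}. ennreal (J f) + ennreal (J g))"
    unfolding content_def using subordinate_zero
    by (intro ennreal_SUP_add_right) blast
  also have "\<dots> \<le> content V + ennreal \<epsilon>"
  proof (rule SUP_least)
    fix g assume "g \<in> {g. subordinate g W}"
    then have g: "subordinate g W" by simp
    \<comment> \<open>The sum of \<open>f\<close> and \<open>g\<close> is at most
      \<open>1 + \<epsilon>\<close>, and dividing by this makes it subordinate to \<open>V\<close>.
      Since \<open>J h \<le> 1\<close>, the factor costs at most \<epsilon>.\<close>
    define h where "h = (1 / (1 + \<epsilon>)) *\<^sub>R (f + g)"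
    have h_eq: "H h x = (H f x + H g x) / (1 + \<epsilon>)" if "x \<in> X" for x
      using that by (simp add: h_def H_scaleR H_add)
    have h: "subordinate h V"
      unfolding subordinate_def
    proof (intro conjI ballI)
      fix x assume x: "x \<in> X"
      show "0 \<le> H h x" using x f g \<epsilon> by (simp add: h_eq subordinate_def)
      have "H f x + H g x \<le> 1 + \<epsilon>"
      proof (cases "x \<in> W")
        case True
        then have "H f x < \<epsilon>" "H g x \<le> 1" using g x by (auto simp: W_def subordinate_def)
        then show ?thesis by simp
      next
        case False
        then have "H g x = 0" "H f x \<le> 1" using f g x by (auto simp: subordinate_def)
        then show ?thesis using \<epsilon> by simp
      qed
      then show "H h x \<le> 1" using x \<epsilon> by (simp add: h_eq)
    next
      fix x assume "x \<in> X - V"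
      then show "H h x = 0" using f g by (simp add: h_eq subordinate_def W_def)
    qed
    have "J h \<le> 1"
      using J_mono[of h e] h by (simp add: subordinate_def H_unit J_unit)
    have "J f + J g = (1 + \<epsilon>) * J h"
      using \<epsilon> by (simp add: h_def linear_scale[OF linear_J] linear_add[OF linear_J])
    also have "\<dots> \<le> J h + \<epsilon>" using \<open>J h \<le> 1\<close> \<epsilon> by (simp add: algebra_simps)
    finally have "ennreal (J f + J g) \<le> ennreal (J h + \<epsilon>)" by (rule ennreal_leI)
    then have "ennreal (J f) + ennreal (J g) \<le> ennreal (J h) + ennreal \<epsilon>"
      using J_subordinate_nonneg[OF f] J_subordinate_nonneg[OF g] J_subordinate_nonneg[OF h] \<epsilon> by simp
    also have "\<dots> \<le> content V + ennreal \<epsilon>"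
      by (intro add_right_mono content_upper h)
    finally show "ennreal (J f) + ennreal (J g) \<le> content V + ennreal \<epsilon>" .
  qed
  finally show "ennreal (J f) + outer (V - U) \<le> content V + ennreal \<epsilon>" .
qed

text \<open>For open test sets the Caratheodory inequality is \<open>content_split\<close> after a
  supremum over \<open>f\<close>; for an arbitrary test set \<open>A\<close> it follows by the
  infimum over open supersets.\<close>

lemma openin_lambda_system:
  assumes U: "openin (top_of_set X) U"
  shows "U \<in> lambda_system X (Pow X) outer"
proof -
  interpret algebra X "Pow X" by (rule algebra_Pow)
  have le: "outer (A \<inter> U) + outer (A - U) \<le> outer A" if "A \<subseteq> X" for A
    unfolding outer_def[of A]
  proof (rule INF_greatest)
    fix V assume "V \<in> {V. A \<subseteq> V \<and> openin (top_of_set X) V}"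
    then have V: "A \<subseteq> V" "openin (top_of_set X) V" by auto
    have "outer (A \<inter> U) + outer (A - U) \<le> outer (V \<inter> U) + outer (V - U)"
      using V by (intro add_mono outer_mono) auto
    also have "outer (V \<inter> U) = content (V \<inter> U)"
      using U V by (intro outer_open openin_Int)
    also have "content (V \<inter> U) + outer (V - U) =
        (SUP f \<in> {f. subordinate f (V \<inter> U)}. ennreal (J f) + outer (V - U))"
      unfolding content_def using subordinate_zero
      by (intro ennreal_SUP_add_left[symmetric]) blast+
    also have "\<dots> \<le> content V"
      using content_split[OF V(2)] by (intro SUP_least) auto
    finally show "outer (A \<inter> U) + outer (A - U) \<le> content V" .
  qed
  have "subadditive (Pow X) outer"
    using outer_measure_space_outer
    by (intro countably_subadditive_subadditive) (auto simp: outer_measure_space_def)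
  then have "outer A \<le> outer (A \<inter> U) + outer (A - U)" if "A \<subseteq> X" for A
    using subadditiveD[of "Pow X" outer "A \<inter> U" "A - U"] that by (auto simp: Int_Diff_Un)
  then show ?thesis
    using le openin_imp_subset[OF U] by (auto simp: lambda_system_eq intro: antisym)
qed

section \<open>The Riesz measure, its regularity and its integral\<close>

definition riesz_measure :: "'a measure" where
  "riesz_measure = measure_of X (sets (restrict_space borel X)) outer"

lemma measure_space_outer: "measure_space X (sets (restrict_space borel X)) outer"
proof -
  have L: "measure_space X (lambda_system X (Pow X) outer) outer"
    by (intro sigma_algebra.caratheodory_lemma sigma_algebra_Pow outer_measure_space_outer)
  then have sa: "sigma_algebra X (lambda_system X (Pow X) outer)"
    by (simp add: measure_space_def)
  interpret L: sigma_algebra X "lambda_system X (Pow X) outer" by (rule sa)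
  \<comment> \<open>\<open>borel\<close> is generated on the whole type while
    \<open>lambda_system\<close> lives on \<open>X\<close>, so the induction runs over the Borel
    sets of the type and treats their traces.\<close>
  have "X \<inter> A \<in> lambda_system X (Pow X) outer" if "A \<in> sigma_sets UNIV {S. open S}" for A
    using that
  proof induction
    case (Basic A)
    then show ?case by (intro openin_lambda_system openin_open_Int) simp
  next
    case (Compl A)
    have "X \<inter> (UNIV - A) = X - X \<inter> A" by blast
    then show ?case using L.compl_sets[OF Compl.IH] by simp
  next
    case (Union A)
    have "(\<Union>i. X \<inter> A i) \<in> lambda_system X (Pow X) outer"
      using Union.IH by (intro L.countable_UN) auto
    then show ?case by simp
  qed simp
  then have "sets (restrict_space borel X) \<subseteq> lambda_system X (Pow X) outer"
    by (auto simp: sets_restrict_space borel_def)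
  then show ?thesis
    using sets.sigma_algebra_axioms[of "restrict_space borel X"]
    by (intro measure_down[OF L]) (auto simp: space_restrict_space)
qed

lemma space_riesz_measure: "space riesz_measure = X"
  unfolding riesz_measure_def
  by (rule space_measure_of) (auto simp: sets_restrict_space)

lemma sets_riesz_measure: "sets riesz_measure = sets (restrict_space borel X)"
  using sigma_algebra.sets_measure_of_eq[of X "sets (restrict_space borel X)" outer]
    sets.sigma_algebra_axioms[of "restrict_space borel X"]
  by (simp add: riesz_measure_def space_restrict_space)

lemma emeasure_riesz_measure:
  assumes "A \<in> sets (restrict_space borel X)"
  shows "emeasure riesz_measure A = outer A"
  using assms measure_space_outer unfolding riesz_measure_def
  by (intro emeasure_measure_of_sigma) (auto simp: measure_space_def)

lemma emeasure_riesz_measure_open: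
  "openin (top_of_set X) U \<Longrightarrow> emeasure riesz_measure U = content U"
  by (simp add: emeasure_riesz_measure openin_sets outer_open)

lemma prob_space_riesz_measure: "prob_space riesz_measure"
  by (rule prob_spaceI) (simp add: space_riesz_measure emeasure_riesz_measure_open content_space)

text \<open>Outer regularity is built into \<open>outer\<close>. For inner regularity, an open
  \<open>U\<close> slightly larger than \<open>X - B\<close> leaves the compact set
  \<open>X - U\<close> inside \<open>B\<close>.\<close>

lemma regular_riesz_measure: "regular_Borel_prob X riesz_measure"
  unfolding regular_Borel_prob_def
proof (intro conjI ballI)
  interpret prob_space riesz_measure by (rule prob_space_riesz_measure)
  fix B assume B: "B \<in> sets riesz_measure"
  have "B \<subseteq> X" using sets.sets_into_space[OF B] by (simp add: space_riesz_measure)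
  have outer_B: "emeasure riesz_measure A = outer A" if "A \<in> events" for A
    using that by (simp add: emeasure_riesz_measure sets_riesz_measure)
  show "emeasure riesz_measure B = (INF U \<in> {U. B \<subseteq> U \<and> openin (top_of_set X) U}. emeasure riesz_measure U)"
    unfolding outer_B[OF B] outer_def by (intro INF_cong) (auto simp: emeasure_riesz_measure_open)
  show "emeasure riesz_measure B = (SUP K \<in> {K. K \<subseteq> B \<and> compact K}. emeasure riesz_measure K)"
  proof (rule antisym)
    show "(SUP K \<in> {K. K \<subseteq> B \<and> compact K}. emeasure riesz_measure K) \<le> emeasure riesz_measure B"
      by (intro SUP_least emeasure_mono B) auto
    show "emeasure riesz_measure B \<le> (SUP K \<in> {K. K \<subseteq> B \<and> compact K}. emeasure riesz_measure K)"
    proof (rule ennreal_le_epsilon)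
      fix \<epsilon> :: real assume \<epsilon>: "0 < \<epsilon>"
      obtain U where U: "X - B \<subseteq> U" "openin (top_of_set X) U" "content U \<le> outer (X - B) + ennreal \<epsilon>"
        using outer_approx[of "X - B" \<epsilon>] \<epsilon> by blast
      have UX: "U \<subseteq> X" using U(2) openin_imp_subset by blast
      have Um: "U \<in> events" using openin_sets[OF U(2)] by (simp add: sets_riesz_measure)
      have XB: "X - B \<in> events" using sets.compl_sets[OF B] by (simp add: space_riesz_measure)
      have "emeasure riesz_measure U \<le> emeasure riesz_measure (X - B) + ennreal \<epsilon>"
        using U(3) by (simp add: emeasure_riesz_measure_open[OF U(2)] outer_B[OF XB])
      \<comment> \<open>Real values turn the passage to complements into a subtraction.\<close>
      then have "prob U \<le> prob (X - B) + \<epsilon>"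
        using \<epsilon> by (simp add: emeasure_eq_measure flip: ennreal_plus)
      moreover have "prob (X - B) = 1 - prob B" "prob (X - U) = 1 - prob U"
        using prob_compl[OF B] prob_compl[OF Um] by (auto simp: space_riesz_measure)
      ultimately have "prob B \<le> prob (X - U) + \<epsilon>" by simp
      then have "emeasure riesz_measure B \<le> emeasure riesz_measure (X - U) + ennreal \<epsilon>"
        using \<epsilon> by (simp add: emeasure_eq_measure flip: ennreal_plus)
      also have "emeasure riesz_measure (X - U) \<le> (SUP K \<in> {K. K \<subseteq> B \<and> compact K}. emeasure riesz_measure K)"
      proof (rule SUP_upper)
        have "compact (X - U)"
          using U(2) by (intro closedin_compact[OF compact_space] closedin_diff) auto
        then show "X - U \<in> {K. K \<subseteq> B \<and> compact K}" using U by auto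
      qed
      finally show "emeasure riesz_measure B \<le>
          (SUP K \<in> {K. K \<subseteq> B \<and> compact K}. emeasure riesz_measure K) + ennreal \<epsilon>"
        by (simp add: add_right_mono)
    qed
  qed
qed (simp_all add: prob_space_riesz_measure space_riesz_measure sets_riesz_measure)

text \<open>Cutting \<open>f\<close> into \<open>n\<close> horizontal slices, \<open>n\<close> times the \<open>k\<close>-th slice is subordinate to
  \<open>{x. k / n < H f x}\<close>.\<close>

lemma J_le_integral_unit:
  assumes f: "\<And>x. x \<in> X \<Longrightarrow> 0 \<le> H f x \<and> H f x \<le> 1" and n: "n > (0::nat)"
  shows "J f \<le> (LINT x|riesz_measure. H f x) + 1 / n"
proof -
  interpret prob_space riesz_measure by (rule prob_space_riesz_measure)
  have "\<exists>h. \<forall>x\<in>X. H h x = min (max (H f x - real k / n) 0) (1 / n)" for k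
  proof -
    obtain g where g: "\<forall>x\<in>X. H g x = max (H (f - (real k / n) *\<^sub>R e) x) (H 0 x)"
      using H_max by blast
    obtain h where "\<forall>x\<in>X. H h x = min (H g x) (H ((1 / n) *\<^sub>R e) x)"
      using H_min by blast
    then show ?thesis using g by (auto simp: H_diff H_scaleR H_unit H_zero)
  qed
  then obtain h where h: "\<And>k x. x \<in> X \<Longrightarrow> H (h k) x = min (max (H f x - real k / n) 0) (1 / n)"
    by metis
  define U where "U k = {x \<in> X. real k / n < H f x}" for k
  have U: "openin (top_of_set X) (U k)" for k unfolding U_def by (rule openin_superlevel)
  have Um: "U k \<in> events" for k using openin_sets[OF U] by (simp add: sets_riesz_measure)
  have "J f = J (\<Sum>k<n. h k)"
  proof (rule J_cong)
    fix x assume x: "x \<in> X"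
    then have "H (\<Sum>k<n. h k) x = (\<Sum>k<n. min (max (H f x - real k / n) 0) (1 / n))"
      by (simp add: H_sum h)
    also have "\<dots> = H f x"
      using f[OF x] n by (simp add: sum_slices)
    finally show "H f x = H (\<Sum>k<n. h k) x" by simp
  qed
  also have "\<dots> = (\<Sum>k<n. J (h k))"
    by (rule linear_sum[OF linear_J])
  also have "\<dots> \<le> (\<Sum>k<n. prob (U k) / n)"
  proof (rule sum_mono)
    fix k
    have "subordinate (real n *\<^sub>R h k) (U k)"
      unfolding subordinate_def
    proof (intro conjI ballI)
      fix y assume y: "y \<in> X"
      have "0 \<le> H (h k) y" "H (h k) y \<le> 1 / n" using n y by (auto simp: h)
      then show "0 \<le> H (real n *\<^sub>R h k) y" "H (real n *\<^sub>R h k) y \<le> 1"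
        using n y by (auto simp: H_scaleR field_simps)
    next
      fix y assume "y \<in> X - U k"
      then show "H (real n *\<^sub>R h k) y = 0" by (auto simp: H_scaleR h U_def)
    qed
    then have "ennreal (J (real n *\<^sub>R h k)) \<le> ennreal (prob (U k))"
      using content_upper U by (simp add: emeasure_riesz_measure_open flip: emeasure_eq_measure)
    then have "real n * J (h k) \<le> prob (U k)"
      by (simp add: linear_scale[OF linear_J])
    then show "J (h k) \<le> prob (U k) / n" using n by (simp add: field_simps)
  qed
  also have "\<dots> = (LINT x|riesz_measure. (\<Sum>k<n. indicator (U k) x / n))"
    using Um by (subst Bochner_Integration.integral_sum) (auto simp: emeasure_eq_measure)
  \<comment> \<open>The step function rounds \<open>H f\<close> up to a multiple of
    \<open>1 / n\<close>.\<close>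
  also have "\<dots> \<le> (LINT x|riesz_measure. H f x + 1 / n)"
  proof (rule integral_mono)
    show "integrable riesz_measure (\<lambda>x. \<Sum>k<n. indicator (U k) x / real n)"
      using Um by (auto simp: emeasure_eq_measure)
    show "integrable riesz_measure (\<lambda>x. H f x + 1 / n)"
      using H_integrable[OF regular_riesz_measure] by simp
    fix x assume x: "x \<in> space riesz_measure"
    then have "x \<in> X" by (simp add: space_riesz_measure)
    then have "(\<Sum>k<n. indicator (U k) x / real n) = (\<Sum>k<n. if real k / n < H f x then 1 / n else 0)"
      by (intro sum.cong) (auto simp: U_def)
    also have "\<dots> \<le> H f x + 1 / n"
      using sum_steps_le[of "H f x" n n] f[OF \<open>x \<in> X\<close>] n by simp
    finally show "(\<Sum>k<n. indicator (U k) x / real n) \<le> H f x + 1 / n" .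
  qed
  also have "\<dots> = (LINT x|riesz_measure. H f x) + 1 / n"
    using H_integrable[OF regular_riesz_measure] by (simp add: prob_space)
  finally show ?thesis .
qed

lemma J_le_integral: "J f \<le> (LINT x|riesz_measure. H f x)"
proof -
  interpret prob_space riesz_measure by (rule prob_space_riesz_measure)
  obtain B where B: "B > 0" "\<forall>x\<in>X. \<bar>H f x\<bar> \<le> B" using H_bounded by blast
  \<comment> \<open>An affine change moves the range of \<open>H f\<close> from
    \<open>[-B, B]\<close> into \<open>[0, 1]\<close>; \<open>J\<close> and the integral transform
    alike because both give the unit the value \<open>1\<close>.\<close>
  define g where "g = (1 / (2 * B)) *\<^sub>R (f + B *\<^sub>R e)"
  have g: "H g x = (H f x + B) / (2 * B)" if "x \<in> X" for x
    using that by (simp add: g_def H_scaleR H_add H_unit)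
  have "J g \<le> (LINT x|riesz_measure. H g x) + \<epsilon>" if "0 < \<epsilon>" for \<epsilon>
  proof -
    obtain m where "inverse (real (Suc m)) < \<epsilon>"
      using reals_Archimedean[OF \<open>0 < \<epsilon>\<close>] by blast
    then obtain n where n: "n > 0" "1 / real n < \<epsilon>"
      by (metis inverse_eq_divide zero_less_Suc)
    have "0 \<le> H g x \<and> H g x \<le> 1" if "x \<in> X" for x
      using B that by (auto simp: g field_simps abs_le_iff)
    from J_le_integral_unit[OF this n(1)] n(2) show ?thesis by simp
  qed
  then have le: "J g \<le> (LINT x|riesz_measure. H g x)" by (rule field_le_epsilon)
  have "(J f + B) / (2 * B) = J g"
    by (simp add: g_def linear_scale[OF linear_J] linear_add[OF linear_J] J_unit)
  also note le
  also have "(LINT x|riesz_measure. H g x) = (LINT x|riesz_measure. (H f x + B) / (2 * B))"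
    by (rule Bochner_Integration.integral_cong) (auto simp: g space_riesz_measure)
  also have "\<dots> = ((LINT x|riesz_measure. H f x) + B) / (2 * B)"
    using H_integrable[OF regular_riesz_measure] by (simp add: prob_space)
  finally show ?thesis using B by (simp add: divide_le_cancel)
qed

text \<open>The inequality for \<open>- f\<close> is the reverse inequality for
  \<open>f\<close>.\<close>

lemma J_eq_integral: "J f = (LINT x|riesz_measure. H f x)"
proof (rule antisym)
  have "- J f \<le> (LINT x|riesz_measure. H (- f) x)"
    using J_le_integral[of "- f"] by (simp add: linear_neg[OF linear_J])
  also have "\<dots> = (LINT x|riesz_measure. - H f x)"
    by (rule Bochner_Integration.integral_cong) (auto simp: H_minus space_riesz_measure)
  finally show "(LINT x|riesz_measure. H f x) \<le> J f" by simp
qed (rule J_le_integral)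

theorem riesz_representation:
  "\<exists>!\<mu>. regular_Borel_prob X \<mu> \<and> (\<forall>f. J f = (LINT x|\<mu>. H f x))"
proof (rule ex1I[of _ riesz_measure])
  show "regular_Borel_prob X riesz_measure \<and> (\<forall>f. J f = (LINT x|riesz_measure. H f x))"
    using regular_riesz_measure J_eq_integral by blast
  fix \<mu> assume \<mu>: "regular_Borel_prob X \<mu> \<and> (\<forall>f. J f = (LINT x|\<mu>. H f x))"
  show "\<mu> = riesz_measure"
    using \<mu> by (intro regular_measure_unique regular_riesz_measure) (simp_all flip: J_eq_integral)
qed

end

section \<open>Ultrafilters and the space \<open>Omega_star\<close>\<close>

text \<open>The condition defining \<open>betaN\<close>, on an arbitrary type: ultrafilters on
  \<open>betaN\<close> and on the real line occur as well.\<close>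

definition ultra :: "'a filter \<Rightarrow> bool" where
  "ultra U \<longleftrightarrow> U \<noteq> bot \<and> (\<forall>P. eventually P U \<or> eventually (\<lambda>x. \<not> P x) U)"

lemma ultra_not: "ultra U \<Longrightarrow> \<not> eventually P U \<longleftrightarrow> eventually (\<lambda>x. \<not> P x) U"
proof -
  assume U: "ultra U"
  have "\<not> (eventually P U \<and> eventually (\<lambda>x. \<not> P x) U)"
    using U by (simp add: ultra_def trivial_limit_def flip: eventually_conj_iff)
  then show ?thesis using U by (auto simp: ultra_def)
qed

lemma ultra_filtermap: "ultra U \<Longrightarrow> ultra (filtermap f U)"
  by (auto simp: ultra_def filtermap_bot_iff eventually_filtermap)

text \<open>An ultrafilter is a minimal proper filter, so Zorn's lemma is applied with the order
  reversed.\<close>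

lemma ultra_extension:
  fixes F :: "'a filter"
  assumes "F \<noteq> bot"
  obtains U where "U \<le> F" "ultra U"
proof -
  define A where "A = {G. G \<le> F \<and> G \<noteq> bot}"
  have "\<exists>m\<in>A. \<forall>a\<in>A. a \<le> m \<longrightarrow> a = m"
  proof (rule predicate_Zorn)
    show "partial_order_on A (relation_of (\<lambda>a b. b \<le> a) A)"
      by (rule partial_order_on_relation_ofI) auto
    fix C assume "C \<in> Chains (relation_of (\<lambda>a b. b \<le> a) A)"
    then have C: "a \<le> b \<or> b \<le> a" if "a \<in> C" "b \<in> C" for a b
      using that unfolding Chains_def relation_of_def by blast
    have CA: "C \<subseteq> A"
      using \<open>C \<in> _\<close> unfolding Chains_def relation_of_def by blast
    \<comment> \<open>Adjoining \<open>F\<close> keeps the infimum below \<open>F\<close> even for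
      the empty chain.\<close>
    define D where "D = insert F C"
    have "\<exists>x\<in>D. x \<le> inf a b" if "a \<in> D" "b \<in> D" for a b
      using that C CA unfolding D_def A_def by (auto simp: le_inf_iff)
    then have "eventually P (Inf D) \<longleftrightarrow> (\<exists>b\<in>D. eventually P b)" for P
      by (intro eventually_Inf_base) (auto simp: D_def)
    then have "Inf D \<noteq> bot"
      using CA assms by (auto simp: trivial_limit_def D_def A_def)
    then have "Inf D \<in> A" by (auto simp: A_def D_def)
    moreover have "\<forall>a\<in>C. Inf D \<le> a" unfolding D_def by (blast intro: Inf_lower)
    ultimately show "\<exists>u\<in>A. \<forall>a\<in>C. u \<le> a" by blast
  qed
  then obtain M where M: "M \<le> F" "M \<noteq> bot" and max: "\<And>a. a \<noteq> bot \<Longrightarrow> a \<le> M \<Longrightarrow> a = M"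
    by (auto simp: A_def intro: order_trans)
  have "eventually P M \<or> eventually (\<lambda>x. \<not> P x) M" for P
  \<comment> \<open>If \<open>P\<close> is compatible with \<open>M\<close>, restricting
    \<open>M\<close> to \<open>P\<close> gives a proper filter below \<open>M\<close>, hence
    \<open>M\<close> itself by minimality.\<close>
  proof (cases "inf M (principal {x. P x}) = bot")
    case True
    then show ?thesis by (simp add: trivial_limit_def eventually_inf_principal)
  next
    case False
    from max[OF this] have "M \<le> principal {x. P x}" by (metis inf.cobounded1 inf.cobounded2)
    then show ?thesis by (simp add: le_principal)
  qed
  with M show ?thesis using that by (auto simp: ultra_def)
qed

text \<open>Compactness yields a cluster point. If \<open>f\<close> were not eventually in a
  neighbourhood of it, the ultrafilter would put \<open>f\<close> eventually outside, against
  clustering.\<close>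

lemma ultra_converges:
  assumes U: "ultra U" and K: "compact K" "eventually (\<lambda>x. f x \<in> K) U"
  obtains l where "l \<in> K" "(f \<longlongrightarrow> l) U"
proof -
  have "filtermap f U \<noteq> bot" using U by (simp add: ultra_def filtermap_bot_iff)
  then obtain l where l: "l \<in> K" "inf (nhds l) (filtermap f U) \<noteq> bot"
    using K by (auto simp: compact_filter eventually_filtermap)
  have "eventually (\<lambda>x. f x \<in> S) U" if S: "open S" "l \<in> S" for S
  proof (rule ccontr)
    assume "\<not> eventually (\<lambda>x. f x \<in> S) U"
    then have "eventually (\<lambda>y. y \<notin> S) (filtermap f U)"
      by (simp add: ultra_not[OF U] eventually_filtermap)
    moreover have "eventually (\<lambda>y. y \<in> S) (nhds l)"
      using S by (rule eventually_nhds_in_open)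
    ultimately have "eventually (\<lambda>_. False) (inf (nhds l) (filtermap f U))"
      unfolding eventually_inf by blast
    with l show False by (simp add: trivial_limit_def)
  qed
  then show ?thesis using that l by (auto simp: tendsto_def)
qed

section \<open>Limits along points of \<open>betaN\<close>, compactness, free ultrafilters\<close>

lemma ultra_filter_of: "ultra (filter_of \<eta>)"
  using filter_of[of \<eta>] by (simp add: ultra_def)

lemma filter_of_betaN_of: "ultra F \<Longrightarrow> filter_of (betaN_of F) = F"
  by (simp add: ultra_def betaN_of_inverse)

lemma filter_of_neq_bot [simp]: "filter_of \<eta> \<noteq> bot"
  using ultra_filter_of by (simp add: ultra_def)

lemma ultra_limit:
  fixes f :: "nat \<Rightarrow> real"
  assumes "\<And>n. \<bar>f n\<bar> \<le> B"
  shows "(f \<longlongrightarrow> Lim (filter_of \<eta>) f) (filter_of \<eta>)"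
proof -
  have "eventually (\<lambda>n. f n \<in> {-B..B}) (filter_of \<eta>)"
    using assms by (intro always_eventually) (auto simp: abs_le_iff minus_le_iff)
  then obtain l where "(f \<longlongrightarrow> l) (filter_of \<eta>)"
    using ultra_converges[OF ultra_filter_of compact_Icc] by blast
  then show ?thesis using tendsto_Lim filter_of_neq_bot by metis
qed

text \<open>The generating sets are closed under finite intersections, so they form a base and not
  only a subbase.\<close>

lemma open_betaN_iff:
  "open S \<longleftrightarrow> (\<forall>\<eta>\<in>S. \<exists>A. eventually (\<lambda>n. n \<in> A) (filter_of \<eta>) \<and>
     {\<zeta>. eventually (\<lambda>n. n \<in> A) (filter_of \<zeta>)} \<subseteq> S)"
proof
  assume "open S"
  then have "generate_topology (range (\<lambda>A. {\<eta>. eventually (\<lambda>n. n \<in> A) (filter_of \<eta>)})) S"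
    by (simp add: open_betaN_def)
  then show "\<forall>\<eta>\<in>S. \<exists>A. eventually (\<lambda>n. n \<in> A) (filter_of \<eta>) \<and>
     {\<zeta>. eventually (\<lambda>n. n \<in> A) (filter_of \<zeta>)} \<subseteq> S"
  proof induction
    case UNIV
    then show ?case by (auto intro: exI[of _ UNIV])
  next
    case (Int a b)
    show ?case
    proof
      fix \<eta> assume "\<eta> \<in> a \<inter> b"
      then obtain A B where
        "eventually (\<lambda>n. n \<in> A) (filter_of \<eta>)" "{\<zeta>. eventually (\<lambda>n. n \<in> A) (filter_of \<zeta>)} \<subseteq> a"
        "eventually (\<lambda>n. n \<in> B) (filter_of \<eta>)" "{\<zeta>. eventually (\<lambda>n. n \<in> B) (filter_of \<zeta>)} \<subseteq> b"
        using Int.IH by (meson IntD1 IntD2)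
      then show "\<exists>A. eventually (\<lambda>n. n \<in> A) (filter_of \<eta>) \<and>
          {\<zeta>. eventually (\<lambda>n. n \<in> A) (filter_of \<zeta>)} \<subseteq> a \<inter> b"
        by (intro exI[of _ "A \<inter> B"]) (auto simp: eventually_conj_iff)
    qed
  next
    case (UN K)
    then show ?case by (meson Union_upper UnionE order_trans)
  next
    case (Basis s)
    then show ?case by blast
  qed
next
  assume S: "\<forall>\<eta>\<in>S. \<exists>A. eventually (\<lambda>n. n \<in> A) (filter_of \<eta>) \<and>
     {\<zeta>. eventually (\<lambda>n. n \<in> A) (filter_of \<zeta>)} \<subseteq> S"
  show "open S"
  proof (rule Topological_Spaces.openI)
    fix \<eta> assume "\<eta> \<in> S"
    then obtain A where A: "eventually (\<lambda>n. n \<in> A) (filter_of \<eta>)"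
      "{\<zeta>. eventually (\<lambda>n. n \<in> A) (filter_of \<zeta>)} \<subseteq> S"
      using S by blast
    moreover have "open {\<zeta>. eventually (\<lambda>n. n \<in> A) (filter_of \<zeta>)}"
      unfolding open_betaN_def by (rule generate_topology.Basis) blast
    ultimately show "\<exists>T. open T \<and> \<eta> \<in> T \<and> T \<subseteq> S" by blast
  qed
qed

lemma compact_betaN: "compact (UNIV :: betaN set)"
  unfolding compact_filter
proof (intro allI impI)
  fix F :: "betaN filter" assume "F \<noteq> bot"
  then obtain G where G: "G \<le> F" "ultra G" by (rule ultra_extension)
  \<comment> \<open>The limit of an ultrafilter \<open>G\<close> of ultrafilters: \<open>H\<close>
    contains the properties that hold \<eta>-eventually for \<open>G\<close>-almost every
    \<eta>.\<close>
  define H where "H = Abs_filter (\<lambda>P. eventually (\<lambda>\<eta>. eventually P (filter_of \<eta>)) G)"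
  have ev_H: "eventually P H \<longleftrightarrow> eventually (\<lambda>\<eta>. eventually P (filter_of \<eta>)) G" for P
    unfolding H_def
    by (rule eventually_Abs_filter, rule is_filter.intro)
       (auto simp: eventually_conj_iff elim!: eventually_mono)
  have "\<not> eventually (\<lambda>_. False) H"
    using G(2) by (simp add: ev_H ultra_def trivial_limit_def[of G])
  moreover have "eventually P H \<or> eventually (\<lambda>n. \<not> P n) H" for P
  proof (cases "eventually P H")
    case False
    then have "eventually (\<lambda>\<eta>. \<not> eventually P (filter_of \<eta>)) G"
      by (simp add: ev_H ultra_not[OF G(2)])
    then show ?thesis by (simp add: ev_H ultra_not[OF ultra_filter_of])
  qed simp
  ultimately have "ultra H"
    by (simp add: ultra_def trivial_limit_def)
  then have H: "filter_of (betaN_of H) = H" by (rule filter_of_betaN_of)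
  have "G \<le> nhds (betaN_of H)"
  proof (rule filter_leI)
    fix P assume "eventually P (nhds (betaN_of H))"
    then obtain S where S: "open S" "betaN_of H \<in> S" "\<forall>x\<in>S. P x"
      unfolding eventually_nhds by blast
    then obtain A where "eventually (\<lambda>n. n \<in> A) H" "{\<zeta>. eventually (\<lambda>n. n \<in> A) (filter_of \<zeta>)} \<subseteq> S"
      unfolding open_betaN_iff using H by metis
    then show "eventually P G" using S(3) unfolding ev_H by (auto elim!: eventually_mono)
  qed
  then have "G \<le> inf (nhds (betaN_of H)) F" using G by simp
  then show "\<exists>x\<in>UNIV. inf (nhds x) F \<noteq> bot"
    using G(2) unfolding ultra_def by (metis UNIV_I bot.extremum_uniqueI)
qed

lemma closed_free_ultrafilters: "closed free_ultrafilters"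
  unfolding closed_def open_betaN_iff
proof
  fix \<eta> assume "\<eta> \<in> - free_ultrafilters"
  then obtain A where "eventually (\<lambda>n. n \<in> A) (filter_of \<eta>)" "finite A"
    by (auto simp: free_ultrafilters_def)
  then show "\<exists>A. eventually (\<lambda>n. n \<in> A) (filter_of \<eta>) \<and>
      {\<zeta>. eventually (\<lambda>n. n \<in> A) (filter_of \<zeta>)} \<subseteq> - free_ultrafilters"
    by (intro exI[of _ A]) (auto simp: free_ultrafilters_def)
qed

lemma free_ultrafilters_iff: "\<eta> \<in> free_ultrafilters \<longleftrightarrow> filter_of \<eta> \<le> sequentially"
proof
  assume \<eta>: "\<eta> \<in> free_ultrafilters"
  have "eventually (\<lambda>n. N \<le> n) (filter_of \<eta>)" for N
  proof (rule ccontr)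
    assume "\<not> ?thesis"
    then have "eventually (\<lambda>n. n \<in> {..<N}) (filter_of \<eta>)"
      by (simp add: ultra_not[OF ultra_filter_of] not_le)
    with \<eta> show False unfolding free_ultrafilters_def by blast
  qed
  then show "filter_of \<eta> \<le> sequentially"
    unfolding le_filter_def eventually_sequentially by (metis (mono_tags, lifting) eventually_mono)
next
  assume le: "filter_of \<eta> \<le> sequentially"
  show "\<eta> \<in> free_ultrafilters"
    unfolding free_ultrafilters_def
  proof safe
    fix A assume A: "eventually (\<lambda>n. n \<in> A) (filter_of \<eta>)" "finite A"
    then have "eventually (\<lambda>n. n \<notin> A) sequentially"
      using eventually_cofinite[of "\<lambda>n. n \<notin> A"] by (simp flip: cofinite_eq_sequentially)
    then have "eventually (\<lambda>n. n \<notin> A) (filter_of \<eta>)" using le by (simp add: le_filter_def)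
    with A(1) have "eventually (\<lambda>_. False) (filter_of \<eta>)" by eventually_elim simp
    then show False by simp
  qed
qed

lemma tau_free:
  assumes "\<eta> \<in> free_ultrafilters" shows "tau \<eta> \<in> free_ultrafilters"
proof -
  have "filtermap Suc (filter_of \<eta>) \<le> filtermap Suc sequentially"
    using assms by (intro filtermap_mono) (simp add: free_ultrafilters_iff)
  also have "\<dots> \<le> sequentially"
    using filterlim_Suc by (simp add: filterlim_def)
  finally show ?thesis by (simp add: free_ultrafilters_iff tau.rep_eq)
qed

text \<open>The preimage is the push-forward under the truncated predecessor;
  \<open>0 - 1 = 0\<close> does no harm because a free ultrafilter contains the positive integers.
  It supplies the other side of the gluing at \<open>t = 0\<close>.\<close>

lemma tau_surj_free:
  assumes "\<eta> \<in> free_ultrafilters" obtains \<zeta> where "\<zeta> \<in> free_ultrafilters" "tau \<zeta> = \<eta>"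
proof -
  define \<zeta> where "\<zeta> = betaN_of (filtermap (\<lambda>n. n - 1) (filter_of \<eta>))"
  have \<zeta>: "filter_of \<zeta> = filtermap (\<lambda>n. n - 1) (filter_of \<eta>)"
    unfolding \<zeta>_def by (intro filter_of_betaN_of ultra_filtermap ultra_filter_of)
  have le: "filter_of \<eta> \<le> sequentially" using assms by (simp add: free_ultrafilters_iff)
  have "filtermap (\<lambda>n. n - 1) (filter_of \<eta>) \<le> filtermap (\<lambda>n. n - 1) sequentially"
    using le by (rule filtermap_mono)
  also have "\<dots> \<le> sequentially"
    using filterlim_minus_const_nat_at_top[of 1] by (simp add: filterlim_def)
  finally have "\<zeta> \<in> free_ultrafilters" by (simp add: free_ultrafilters_iff \<zeta>)
  moreover have "filter_of (tau \<zeta>) = filter_of \<eta>"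
  proof -
    have pos: "eventually (\<lambda>n. 0 < n) (filter_of \<eta>)"
      using le eventually_gt_at_top[of "0::nat"] by (simp add: le_filter_def)
    have "eventually P (filter_of (tau \<zeta>)) = eventually P (filter_of \<eta>)" for P
    proof -
      have "eventually P (filter_of (tau \<zeta>)) = eventually (\<lambda>n. P (Suc (n - 1))) (filter_of \<eta>)"
        by (simp add: tau.rep_eq \<zeta> eventually_filtermap)
      also have "\<dots> = eventually P (filter_of \<eta>)"
        by (rule eventually_cong[OF pos]) simp
      finally show ?thesis .
    qed
    then show ?thesis by (simp add: filter_eq_iff)
  qed
  then have "tau \<zeta> = \<eta>" by (simp add: filter_of_inject)
  ultimately show ?thesis using that by blast
qed

section \<open>The mapping torus and its free part\<close>

lemma Omega_rel_refl: "p \<in> cylinder \<Longrightarrow> Omega_rel p p"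
  by (simp add: Omega_rel_def)

lemma abs_Omega_glue: "abs_Omega (\<eta>, 1) = abs_Omega (tau \<eta>, 0)"
proof -
  have "equivclp glue (\<eta>, 1) (tau \<eta>, 0)"
    by (rule r_into_equivclp) (rule glue.intros)
  then have "Omega_rel (\<eta>, 1) (tau \<eta>, 0)" by (simp add: Omega_rel_def)
  then show ?thesis
    using Quotient_rel_abs[OF Quotient_Omega] by blast
qed

lemma continuous_on_abs_Omega: "continuous_on cylinder abs_Omega"
proof (unfold continuous_on_open_invariant, intro allI impI)
  fix U :: "Omega set" assume "open U"
  then obtain T where "open T" "{p \<in> cylinder. abs_Omega p \<in> U} = cylinder \<inter> T"
    unfolding open_Omega_def openin_open by blast
  then show "\<exists>A. open A \<and> A \<inter> cylinder = abs_Omega -` U \<inter> cylinder"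
    by (intro exI[of _ T]) auto
qed

lemma compact_Omega_star: "compact Omega_star"
proof -
  have "compact (UNIV \<inter> free_ultrafilters)"
    by (rule compact_Int_closed[OF compact_betaN closed_free_ultrafilters])
  then have "compact (free_ultrafilters \<times> {0..1::real})"
    by (intro compact_Times) auto
  moreover have "continuous_on (free_ultrafilters \<times> {0..1}) abs_Omega"
    by (rule continuous_on_subset[OF continuous_on_abs_Omega]) auto
  ultimately show ?thesis
    unfolding Omega_star_def by (intro compact_continuous_image)
qed

text \<open>An end point \<open>(\<eta>, 1)\<close> is moved to \<open>(tau \<eta>, 0)\<close>, and
  \<open>tau\<close> keeps the ultrafilter free.\<close>

lemma Omega_star_cases:
  assumes "\<omega> \<in> Omega_star"
  obtains \<eta> t where "\<omega> = abs_Omega (\<eta>, t)" "\<eta> \<in> free_ultrafilters" "0 \<le> t" "t < 1"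
proof -
  obtain \<eta> t where \<eta>: "\<omega> = abs_Omega (\<eta>, t)" "\<eta> \<in> free_ultrafilters" "0 \<le> t" "t \<le> 1"
    using assms by (auto simp: Omega_star_def)
  show ?thesis
  proof (cases "t = 1")
    case True
    then show ?thesis using \<eta> that[of "tau \<eta>" 0] by (simp add: abs_Omega_glue tau_free)
  next
    case False
    then show ?thesis using \<eta> that by simp
  qed
qed

lemma psi_abs:
  "0 \<le> t \<Longrightarrow> t \<le> 1 \<Longrightarrow>
    psi (abs_Omega (\<eta>, t)) f = Lim (filter_of \<eta>) (\<lambda>n. mean f (2 powr t * 2 ^ n))"
  using psi.abs_eq[OF Omega_rel_refl[of "(\<eta>, t)"]] by simp

section \<open>Means of bounded functions\<close>

text \<open>Good representatives: with a bound at every point of the line they are integrable on all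
  sets of finite measure, so means become gauge integrals over intervals.\<close>

definition bounded_fun :: "real \<Rightarrow> (real \<Rightarrow> real) \<Rightarrow> bool" where
  "bounded_fun C g \<longleftrightarrow> g \<in> borel_measurable lebesgue \<and> (\<forall>x. \<bar>g x\<bar> \<le> C)"

lemma bounded_fun_absolutely_integrable:
  assumes "bounded_fun C g" "S \<in> lmeasurable"
  shows "g absolutely_integrable_on S"
proof (rule measurable_bounded_by_integrable_imp_absolutely_integrable)
  show "g \<in> borel_measurable (lebesgue_on S)"
    using assms by (auto simp: bounded_fun_def intro: measurable_restrict_space1)
  show "S \<in> sets lebesgue" using assms by auto
  show "(\<lambda>_. C) integrable_on S"
    using assms(2) by (rule integrable_on_const)
qed (use assms in \<open>auto simp: bounded_fun_def\<close>)

lemma bounded_fun_integrable: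
  "bounded_fun C g \<Longrightarrow> S \<in> lmeasurable \<Longrightarrow> g integrable_on S"
  using bounded_fun_absolutely_integrable by (rule set_lebesgue_integral_eq_integral(1))

lemma bounded_fun_ess_bounded: "bounded_fun C g \<Longrightarrow> ess_bounded g"
  unfolding ess_bounded_def bounded_fun_def
  by (auto intro: measurable_restrict_space1)

lemma Linf_cases:
  obtains g C where "bounded_fun C g" "f = abs_Linf g"
proof -
  obtain h where h: "Linf_rel h h" "f = abs_Linf h"
    using Quotient_abs_rep[OF Quotient_Linf] Quotient_rep_reflp[OF Quotient_Linf] by metis
  then obtain C where C: "AE x in lebesgue_on {1..}. \<bar>h x\<bar> \<le> C"
    and hm: "h \<in> borel_measurable (lebesgue_on {1..})"
    by (auto simp: Linf_rel_def ess_bounded_def)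
  \<comment> \<open>Clamping and extending by \<open>0\<close> change \<open>h\<close> only on a
    null set of the half-line and make the bound hold everywhere; \<open>\<bar>C\<bar>\<close> keeps
    the clamping interval nonempty.\<close>
  define g where "g x = (if x \<in> {1..} then max (- \<bar>C\<bar>) (min \<bar>C\<bar> (h x)) else 0)" for x
  have "(\<lambda>x. max (- \<bar>C\<bar>) (min \<bar>C\<bar> (h x))) \<in> borel_measurable (lebesgue_on {1..})"
    using hm by measurable
  then have "g \<in> borel_measurable lebesgue"
    unfolding g_def by (intro borel_measurable_if_I) auto
  then have g: "bounded_fun \<bar>C\<bar> g"
    by (auto simp: bounded_fun_def g_def)
  moreover have "AE x in lebesgue_on {1..}. h x = g x"
    using C AE_space by eventually_elim (auto simp: g_def)
  then have "Linf_rel h g"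
    using h bounded_fun_ess_bounded[OF g] by (auto simp: Linf_rel_def)
  then have "f = abs_Linf g" using h Quotient_rel_abs[OF Quotient_Linf] by metis
  ultimately show ?thesis by (rule that)
qed

lemma mean_abs:
  assumes "bounded_fun C g"
  shows "mean (abs_Linf g) x = integral {1..x} g / x"
proof -
  have "Linf_rel g g" using bounded_fun_ess_bounded[OF assms] by (auto simp: Linf_rel_def)
  then have "mean (abs_Linf g) x = (1 / x) * (LINT t|lebesgue_on {1..x}. g t)"
    by (simp add: mean.abs_eq)
  also have "(LINT t|lebesgue_on {1..x}. g t) = integral {1..x} g"
    using bounded_fun_absolutely_integrable[OF assms lmeasurable_interval(1)[of 1 x]]
    by (intro lebesgue_integral_eq_integral absolutely_integrable_imp_integrable) auto
  finally show ?thesis by simp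
qed

lemma bounded_fun_combine:
  assumes "bounded_fun C g" "a \<le> b" "b \<le> c"
  shows "integral {a..c} g = integral {a..b} g + integral {b..c} g"
  by (rule Henstock_Kurzweil_Integration.integral_combine[OF assms(2,3)
      bounded_fun_integrable[OF assms(1)], symmetric]) auto

lemma bounded_fun_integral_le:
  assumes "bounded_fun C g" "a \<le> b"
  shows "\<bar>integral {a..b} g\<bar> \<le> C * (b - a)"
proof -
  have "norm (integral {a..b} g) \<le> integral {a..b} (\<lambda>_. C)"
    using assms by (intro integral_norm_bound_integral bounded_fun_integrable)
      (auto simp: bounded_fun_def)
  then show ?thesis using assms by (simp add: mult.commute)
qed

lemma mean_bounded: "\<exists>C. \<forall>x\<ge>1. \<bar>mean f x\<bar> \<le> C"
proof -
  obtain g C where g: "bounded_fun C g" "f = abs_Linf g" by (rule Linf_cases)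
  have "\<bar>mean f x\<bar> \<le> C" if "x \<ge> 1" for x
  proof -
    have "0 \<le> C" using g(1) unfolding bounded_fun_def by (meson abs_ge_zero order_trans)
    then have "C * (x - 1) \<le> C * x" by (simp add: mult_left_mono)
    then have "\<bar>integral {1..x} g\<bar> \<le> C * x" using bounded_fun_integral_le[OF g(1) that] by simp
    then show ?thesis using that by (simp add: g(2) mean_abs[OF g(1)] field_simps)
  qed
  then show ?thesis by blast
qed

text \<open>Multiplied by \<open>y\<close>, the difference of the means is the integral over
  \<open>{x..y}\<close> minus \<open>mean f x * (y - x)\<close>, each at most
  \<open>C * (y - x)\<close> in absolute value. The resulting bound sees only the ratio
  \<open>y / x\<close>, so it is uniform over the dyadic scales.\<close>

lemma mean_Lipschitz:
  "\<exists>C\<ge>0. \<forall>x y. 1 \<le> x \<longrightarrow> x \<le> y \<longrightarrow> \<bar>mean f y - mean f x\<bar> \<le> C * (y / x - 1)"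
proof -
  obtain g C where g: "bounded_fun C g" "f = abs_Linf g" by (rule Linf_cases)
  have C: "0 \<le> C" using g(1) unfolding bounded_fun_def by (meson abs_ge_zero order_trans)
  have "\<bar>mean f y - mean f x\<bar> \<le> 2 * C * (y / x - 1)" if xy: "1 \<le> x" "x \<le> y" for x y
  proof -
    define P where "P = (\<lambda>x. integral {1..x} g)"
    have Py: "P y = P x + integral {x..y} g" unfolding P_def by (rule bounded_fun_combine[OF g(1) xy])
    have Px: "\<bar>P x\<bar> \<le> C * x"
    proof -
      have "C * (x - 1) \<le> C * x" using C by (simp add: mult_left_mono)
      then show ?thesis using bounded_fun_integral_le[OF g(1) xy(1)] by (simp add: P_def)
    qed
    have d: "\<bar>integral {x..y} g\<bar> \<le> C * (y - x)" by (rule bounded_fun_integral_le[OF g(1) xy(2)])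
    have mean_P: "mean f z = P z / z" for z by (simp add: g(2) mean_abs[OF g(1)] P_def)
    have eq: "y * (mean f y - mean f x) = integral {x..y} g - P x / x * (y - x)"
      unfolding mean_P Py using xy by (simp add: field_simps)
    have "\<bar>P x / x\<bar> \<le> C" using Px xy by (simp add: field_simps)
    then have "\<bar>P x / x * (y - x)\<bar> \<le> C * (y - x)"
      using xy C unfolding abs_mult by (intro mult_mono) auto
    then have "\<bar>y * (mean f y - mean f x)\<bar> \<le> 2 * C * (y - x)"
      unfolding eq using d by linarith
    then have "y * \<bar>mean f y - mean f x\<bar> \<le> 2 * C * (y - x)"
      using xy by (simp add: abs_mult)
    moreover have "x * \<bar>mean f y - mean f x\<bar> \<le> y * \<bar>mean f y - mean f x\<bar>"
      using xy by (intro mult_right_mono) auto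
    ultimately have "x * \<bar>mean f y - mean f x\<bar> \<le> 2 * C * (y - x)" by linarith
    moreover have "2 * C * (y / x - 1) = 2 * C * (y - x) / x" using xy by (simp add: field_simps)
    ultimately show ?thesis using xy by (simp add: pos_le_divide_eq mult.commute)
  qed
  then show ?thesis using C by (intro exI[of _ "2 * C"]) auto
qed

lemma mean_add: "mean (f + g) x = mean f x + mean g x"
proof -
  obtain f' C where f: "bounded_fun C f'" "f = abs_Linf f'" by (rule Linf_cases)
  obtain g' D where g: "bounded_fun D g'" "g = abs_Linf g'" by (rule Linf_cases)
  have "f + g = abs_Linf (\<lambda>x. f' x + g' x)"
    using bounded_fun_ess_bounded[OF f(1)] bounded_fun_ess_bounded[OF g(1)]
    by (simp add: f(2) g(2) plus_Linf.abs_eq Linf_rel_def)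
  moreover have "bounded_fun (C + D) (\<lambda>x. f' x + g' x)"
    using f(1) g(1) by (auto simp: bounded_fun_def intro: order_trans[OF abs_triangle_ineq] add_mono)
  moreover have "integral {1..x} (\<lambda>x. f' x + g' x) = integral {1..x} f' + integral {1..x} g'"
    by (intro Henstock_Kurzweil_Integration.integral_add bounded_fun_integrable[OF f(1)] bounded_fun_integrable[OF g(1)]) auto
  ultimately show ?thesis
    by (simp add: mean_abs mean_abs[OF f(1)] mean_abs[OF g(1)] f(2) g(2) add_divide_distrib)
qed

lemma mean_scaleR: "mean (c *\<^sub>R f) x = c * mean f x"
proof -
  obtain f' C where f: "bounded_fun C f'" "f = abs_Linf f'" by (rule Linf_cases)
  have "c *\<^sub>R f = abs_Linf (\<lambda>x. c * f' x)"
    using bounded_fun_ess_bounded[OF f(1)] by (simp add: f(2) scaleR_Linf.abs_eq Linf_rel_def)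
  moreover have "bounded_fun (\<bar>c\<bar> * C) (\<lambda>x. c * f' x)"
    using f(1) by (auto simp: bounded_fun_def abs_mult intro: mult_left_mono)
  ultimately show ?thesis
    by (simp add: mean_abs mean_abs[OF f(1)] f(2))
qed

lemma mean_unit: "\<exists>e. \<forall>x\<ge>1. mean e x = (x - 1) / x"
proof -
  have "bounded_fun 1 (\<lambda>_. 1)" by (simp add: bounded_fun_def)
  then show ?thesis by (intro exI[of _ "abs_Linf (\<lambda>_. 1)"]) (auto simp: mean_abs)
qed

section \<open>The positive part of a primitive\<close>

context
  fixes C :: real and p :: "real \<Rightarrow> real" and P :: "real \<Rightarrow> real"
  assumes p: "bounded_fun C p"
    and P: "P = (\<lambda>x. integral {1..x} p)"
begin

lemma primitive_continuous: "continuous_on {1..c} P"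
  unfolding P by (intro indefinite_integral_continuous_1 bounded_fun_integrable[OF p]) auto

lemma open_positive_set: "open ({1<..<c} \<inter> P -` {0<..})"
  by (intro continuous_open_preimage continuous_on_subset[OF primitive_continuous[of c]]) auto

text \<open>The set where \<open>P\<close> is positive splits into countably many open intervals.
  \<open>P\<close> vanishes at both ends of each, so \<open>p\<close> has integral \<open>0\<close>
  over it, and countable additivity concludes. The hypothesis on \<open>P c\<close> covers an
  interval that ends at \<open>c\<close>.\<close>

lemma integral_positive_set:
  assumes c: "1 \<le> c" "P c \<le> 0"
  shows "integral {1..c} (\<lambda>t. if 0 < P t then p t else 0) = 0"
proof -
  define V where "V = {t \<in> {1<..<c}. 0 < P t}"
  have "V = {1<..<c} \<inter> P -` {0<..}" by (auto simp: V_def)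
  then have "open V" using open_positive_set by simp
  have V_bounds: "V \<subseteq> {1..c}" by (auto simp: V_def)
  have comp: "(LINT x:K|lebesgue. p x) = 0" if K: "K \<in> components V" for K
  proof -
    have KV: "K \<subseteq> V" and "K \<noteq> {}" and "connected K" and "open K"
      using in_components_subset[OF K] in_components_nonempty[OF K] in_components_connected[OF K]
        open_components[OF \<open>open V\<close> K] by simp_all
    define a where "a = Inf K"
    define b where "b = Sup K"
    have bdd: "bdd_below K" "bdd_above K"
      using KV V_bounds bdd_below_mono[of "{1..c}" K] bdd_above_mono[of "{1..c}" K] by auto
    have sub: "K \<subseteq> {a..b}"
      using bdd by (auto simp: a_def b_def cInf_lower cSup_upper)
    have sup: "{a<..<b} \<subseteq> K"
    proof
      fix t assume t: "t \<in> {a<..<b}"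
      obtain u where "u \<in> K" "u < t" using t \<open>K \<noteq> {}\<close> bdd cInf_less_iff[of K t] by (auto simp: a_def)
      moreover obtain v where "v \<in> K" "t < v" using t \<open>K \<noteq> {}\<close> bdd less_cSup_iff[of K t] by (auto simp: b_def)
      ultimately show "t \<in> K"
        using \<open>connected K\<close> connected_contains_Icc[of K u v] by auto
    qed
    have ab: "1 \<le> a" "a \<le> b" "b \<le> c"
    proof -
      show "1 \<le> a" unfolding a_def using KV V_bounds \<open>K \<noteq> {}\<close> by (intro cInf_greatest) auto
      show "b \<le> c" unfolding b_def using KV V_bounds \<open>K \<noteq> {}\<close> by (intro cSup_least) auto
      show "a \<le> b" using sub \<open>K \<noteq> {}\<close> by auto
    qed
    \<comment> \<open>A ball inside \<open>V\<close> that meets the component lies in it. An end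
      point in \<open>V\<close> would thus push the component beyond its own infimum or
      supremum.\<close>
    have max: "ball t e \<subseteq> K" if "ball t e \<subseteq> V" "ball t e \<inter> K \<noteq> {}" for t e
      using components_maximal[OF K connected_ball that(1)] that(2) by (auto simp: Int_commute)
    have "a \<notin> V"
    proof
      assume "a \<in> V"
      then obtain e where e: "e > 0" "ball a e \<subseteq> V" using \<open>open V\<close> open_contains_ball by blast
      obtain u where u: "u \<in> K" "u < a + e"
        using e \<open>K \<noteq> {}\<close> bdd cInf_less_iff[of K "a + e"] by (auto simp: a_def)
      moreover have "a \<le> u" using u sub by auto
      ultimately have "u \<in> ball a e" by (auto simp: dist_real_def)
      then have "ball a e \<subseteq> K" using max e u by blast
      moreover have "a - e / 2 \<in> ball a e" using e by (auto simp: dist_real_def)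
      ultimately have "a - e / 2 \<in> K" by blast
      then show False using sub e by auto
    qed
    have "b \<notin> V"
    proof
      assume "b \<in> V"
      then obtain e where e: "e > 0" "ball b e \<subseteq> V" using \<open>open V\<close> open_contains_ball by blast
      obtain u where u: "u \<in> K" "b - e < u"
        using e \<open>K \<noteq> {}\<close> bdd less_cSup_iff[of K "b - e"] by (auto simp: b_def)
      moreover have "u \<le> b" using u sub by auto
      ultimately have "u \<in> ball b e" by (auto simp: dist_real_def)
      then have "ball b e \<subseteq> K" using max e u by blast
      moreover have "b + e / 2 \<in> ball b e" using e by (auto simp: dist_real_def)
      ultimately have "b + e / 2 \<in> K" by blast
      then show False using sub e by auto
    qed
    have "a < b"
    proof (rule ccontr)
      assume "\<not> a < b"
      then have "K \<subseteq> {a}" using sub by auto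
      then show False using \<open>K \<noteq> {}\<close> \<open>a \<notin> V\<close> KV by auto
    qed
    have cont: "continuous_on {a..b} P"
      by (rule continuous_on_subset[OF primitive_continuous[of c]]) (use ab in auto)
    \<comment> \<open>Continuity makes \<open>P\<close> nonnegative at the end points. Being outside
      \<open>V\<close> gives the other inequality, except for ends at \<open>1\<close> and
      \<open>c\<close>, where \<open>P 1 = 0\<close> and \<open>P c \<le> 0\<close> serve
      instead.\<close>
    have pos: "0 \<le> P t" if "t \<in> {a..b}" for t
    proof -
      have posK: "0 \<le> P x" if "x \<in> {a<..<b}" for x
      proof -
        have "x \<in> V" using that sup KV by blast
        then show ?thesis by (simp add: V_def)
      qed
      have cl: "closure {a<..<b} = {a..b}" using \<open>a < b\<close> by simp
      show ?thesis
        by (rule continuous_ge_on_closure[of "{a<..<b}" P t 0])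
          (use cl cont that posK in \<open>simp_all only:\<close>)
    qed
    have P1: "P 1 = 0" by (simp add: P)
    have "P a = 0"
    proof (cases "a = 1")
      case False
      then have "P a \<le> 0" using \<open>a \<notin> V\<close> ab \<open>a < b\<close> by (simp add: V_def)
      then show ?thesis using pos[of a] \<open>a < b\<close> by simp
    qed (simp add: P1)
    moreover have "P b = 0"
    proof -
      have "P b \<le> 0" using \<open>b \<notin> V\<close> ab \<open>a < b\<close> c by (cases "b = c") (simp_all add: V_def)
      then show ?thesis using pos[of b] \<open>a < b\<close> by simp
    qed
    moreover have "P b = P a + integral {a..b} p"
      unfolding P using ab by (intro bounded_fun_combine[OF p])
    ultimately have "integral {a..b} p = 0" by simp
    moreover have "integral K p = integral {a..b} p"
    proof (rule integral_spike_set)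
      have "K - {a..b} = {}" "{a..b} - K \<subseteq> {a, b}" using sub sup by force+
      then have *: "{x \<in> K - {a..b}. p x \<noteq> 0} \<subseteq> {a, b}" "{x \<in> {a..b} - K. p x \<noteq> 0} \<subseteq> {a, b}" by blast+
      have "negligible {a, b}" by simp
      then show "negligible {x \<in> K - {a..b}. p x \<noteq> 0}" "negligible {x \<in> {a..b} - K. p x \<noteq> 0}"
        using *[THEN negligible_subset[rotated]] by blast+
    qed
    moreover have "K \<in> lmeasurable"
      using \<open>open K\<close> sub by (intro lmeasurable_open bounded_subset[OF bounded_closed_interval])
    then have "(LINT x:K|lebesgue. p x) = integral K p"
      by (intro set_lebesgue_integral_eq_integral(2) bounded_fun_absolutely_integrable[OF p])
    ultimately show ?thesis by simp
  qed
  define K where "K = components V"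
  have "countable K"
    unfolding K_def using \<open>open V\<close> pairwise_disjoint_components
    by (intro countable_disjoint_open_subsets) (auto simp: open_components disjnt_def pairwise_def)
  define A where "A i = (if i \<in> to_nat_on K ` K then from_nat_into K i else {})" for i
  have A_in: "A i \<in> insert {} K" for i
    using \<open>countable K\<close> by (auto simp: A_def)
  have A_to: "A (to_nat_on K X) = X" if "X \<in> K" for X
    using that \<open>countable K\<close> by (simp add: A_def)
  have UA: "(\<Union>i. A i) = V"
  proof -
    have "(\<Union>i. A i) = \<Union>K"
    proof
      show "(\<Union>i. A i) \<subseteq> \<Union>K" using A_in by (intro UN_least) (metis Union_upper empty_subsetI insertE)
      show "\<Union>K \<subseteq> (\<Union>i. A i)" using A_to by (intro Union_least) (metis UNIV_I UN_upper)
    qed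
    then show ?thesis by (simp add: K_def)
  qed
  have V_lm: "V \<in> lmeasurable"
    using \<open>open V\<close> V_bounds by (intro lmeasurable_open bounded_subset[OF bounded_closed_interval])
  have "(LINT x:(\<Union>i. A i)|lebesgue. p x) = (\<Sum>i. (LINT x:A i|lebesgue. p x))"
  proof (rule lebesgue_integral_countable_add)
    show "A i \<in> sets lebesgue" for i
      using A_in[of i] open_components[OF \<open>open V\<close>] by (auto simp: K_def)
    show "A i \<inter> A j = {}" if "i \<noteq> j" for i j
    proof (rule ccontr)
      assume ne: "A i \<inter> A j \<noteq> {}"
      then have in_img: "i \<in> to_nat_on K ` K" "j \<in> to_nat_on K ` K"
        unfolding A_def by (metis inf_bot_left, metis inf_bot_right)
      then obtain X Y where XY: "X \<in> K" "Y \<in> K" "i = to_nat_on K X" "j = to_nat_on K Y" by blast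
      then have "X \<inter> Y \<noteq> {}" using ne A_to by auto
      then have "X = Y" using XY(1,2) components_nonoverlap unfolding K_def by metis
      with XY that show False by simp
    qed
    show "set_integrable lebesgue (\<Union>i. A i) p"
      unfolding UA by (rule bounded_fun_absolutely_integrable[OF p V_lm])
  qed
  also have "\<dots> = 0"
  proof -
    have "(LINT x:A i|lebesgue. p x) = 0" for i
      using A_in[of i] comp by (auto simp: K_def set_lebesgue_integral_def)
    then show ?thesis by simp
  qed
  finally have "integral V p = 0"
    using bounded_fun_absolutely_integrable[OF p V_lm] by (simp add: UA set_lebesgue_integral_eq_integral(2))
  moreover have "integral {1..c} (\<lambda>t. if 0 < P t then p t else 0) = integral {1..c} (\<lambda>t. if t \<in> V then p t else 0)"
  proof (rule Henstock_Kurzweil_Integration.integral_cong)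
    fix t assume t: "t \<in> {1..c}"
    have "P 1 = 0" by (simp add: P)
    then show "(if 0 < P t then p t else 0) = (if t \<in> V then p t else 0)"
      using t c by (auto simp: V_def order_less_le)
  qed
  moreover have "\<dots> = integral ({1..c} \<inter> V) p"
    by (simp add: Int_commute flip: Henstock_Kurzweil_Integration.integral_restrict_Int)
  moreover have "{1..c} \<inter> V = V" using V_bounds by auto
  ultimately show ?thesis by simp
qed

lemma positive_set_bounded_fun: "bounded_fun C (\<lambda>t. if 1 < t \<and> 0 < P t then p t else 0)"
proof -
  have "open {t \<in> {1<..}. 0 < P t}"
  proof -
    have "{t \<in> {1<..}. 0 < P t} = (\<Union>c. {1<..<c} \<inter> P -` {0<..})"
      using gt_ex by auto
    then show ?thesis using open_positive_set by (simp only:) (intro open_UN ballI)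
  qed
  then have "{t \<in> {1<..}. 0 < P t} \<in> sets borel" by (rule borel_open)
  then have "{t. 1 < t \<and> 0 < P t} \<in> sets lebesgue" by simp
  have "(\<lambda>t. if t \<in> {t \<in> {1<..}. 0 < P t} then p t else 0) \<in> borel_measurable lebesgue"
    using p \<open>{t. 1 < t \<and> 0 < P t} \<in> sets lebesgue\<close>
    by (intro measurable_If_set) (auto simp: bounded_fun_def)
  then show ?thesis
    using p by (auto simp: bounded_fun_def intro: order_trans[OF abs_ge_zero])
qed

text \<open>If \<open>P x\<close> is positive, cut at the last point \<open>c\<close> of
  \<open>{1..x}\<close> where \<open>P\<close> is not: up to \<open>c\<close> the integral is
  \<open>0\<close>, and beyond it the integrand is \<open>p\<close>.\<close>

lemma integral_positive_part:
  assumes x: "1 \<le> x"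
  shows "integral {1..x} (\<lambda>t. if 1 < t \<and> 0 < P t then p t else 0) = max 0 (P x)"
proof -
  define h where "h = (\<lambda>t. if 1 < t \<and> 0 < P t then p t else 0)"
  have h: "bounded_fun C h" unfolding h_def by (rule positive_set_bounded_fun)
  have P1: "P 1 = 0" by (simp add: P)
  have h_zero: "integral {1..c} h = 0" if c: "1 \<le> c" "P c \<le> 0" for c
  proof -
    have "integral {1..c} h = integral {1..c} (\<lambda>t. if 0 < P t then p t else 0)"
      using P1 by (intro Henstock_Kurzweil_Integration.integral_cong) (auto simp: h_def order_le_less)
    then show ?thesis using integral_positive_set[OF c] by simp
  qed
  show ?thesis
  proof (cases "P x \<le> 0")
    case True
    then show ?thesis using h_zero[OF x] by (simp add: h_def)
  next
    case False
    define S where "S = {t \<in> {1..x}. P t \<in> {..0}}"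
    have "closed S"
      unfolding S_def using continuous_closed_preimage[OF primitive_continuous[of x] closed_atLeastAtMost closed_atMost]
      by (simp add: vimage_def Int_def)
    moreover have "1 \<in> S" using P1 x by (simp add: S_def)
    moreover have bdd: "bdd_above S" by (auto simp: S_def intro: bdd_aboveI)
    ultimately have "Sup S \<in> S" using closed_contains_Sup by blast
    define c where "c = Sup S"
    have c: "1 \<le> c" "c \<le> x" "P c \<le> 0" using \<open>Sup S \<in> S\<close> by (auto simp: S_def c_def)
    have upper: "t \<le> c" if "1 \<le> t" "t \<le> x" "P t \<le> 0" for t
      unfolding c_def using that bdd by (intro cSup_upper) (auto simp: S_def)
    \<comment> \<open>The intermediate value theorem gives a zero in \<open>{c..x}\<close>;
      maximality of \<open>c\<close> makes it \<open>c\<close> itself.\<close>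
    have "\<exists>t\<ge>c. t \<le> x \<and> P t = 0"
      using c False by (intro IVT' continuous_on_subset[OF primitive_continuous[of x]]) auto
    then obtain t where "c \<le> t" "t \<le> x" "P t = 0" by blast
    then have "P c = 0" using upper[of t] c by (metis antisym order_refl order_trans)
    have "integral {1..x} h = integral {1..c} h + integral {c..x} h"
      using c by (intro bounded_fun_combine[OF h])
    also have "integral {1..c} h = 0" by (rule h_zero) (use c in auto)
    also have "integral {c..x} h = integral {c..x} p"
    proof (rule integral_spike[of "{c}"])
      fix t assume "t \<in> {c..x} - {c}"
      then show "p t = h t" using upper[of t] c by (auto simp: h_def not_le[symmetric])
    qed auto
    also have "0 + integral {c..x} p = P x"
      using bounded_fun_combine[OF p c(1,2)] \<open>P c = 0\<close> by (simp add: P)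
    finally show ?thesis using False by (simp add: h_def)
  qed
qed

end

text \<open>The maximum is \<open>mean g\<close> plus the positive part of
  \<open>mean (f - g)\<close>, and that part is the mean of the restricted integrand
  \<open>h\<close>.\<close>

lemma mean_max: "\<exists>h. \<forall>x\<ge>1. mean h x = max (mean f x) (mean g x)"
proof -
  obtain p C where p: "bounded_fun C p" "f - g = abs_Linf p" by (rule Linf_cases)
  define P where "P = (\<lambda>x. integral {1..x} p)"
  define h where "h = (\<lambda>t. if 1 < t \<and> 0 < P t then p t else 0)"
  have h: "bounded_fun C h"
    unfolding h_def using p(1) P_def by (rule positive_set_bounded_fun)
  have "mean (abs_Linf h + g) x = max (mean f x) (mean g x)" if "1 \<le> x" for x
  proof -
    have "f = abs_Linf p + g" using p(2) by (metis diff_add_cancel)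
    then have f: "mean f x = P x / x + mean g x"
      by (simp add: mean_add mean_abs[OF p(1)] P_def)
    have "integral {1..x} h = max 0 (P x)"
      unfolding h_def using p(1) P_def that by (rule integral_positive_part)
    then have "mean (abs_Linf h + g) x = max 0 (P x) / x + mean g x"
      by (simp add: mean_add mean_abs[OF h])
    also have "\<dots> = max (mean f x) (mean g x)"
      using that by (simp add: f max_divide_distrib_right max_add_distrib_left max.commute)
    finally show ?thesis .
  qed
  then show ?thesis by blast
qed

text \<open>The test function is \<open>1\<close> on \<open>{b - \<kappa> b<..b}\<close> and \<open>-1\<close> on \<open>{b<..b + \<kappa> b}\<close> for each
  \<open>b = \<theta> 2^n\<close> with \<open>n \<in> A\<close>, so that its primitive is a sum of disjointly supported tents.\<close>

lemma mean_tents: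
  assumes \<theta>: "1 \<le> \<theta>" and \<kappa>: "0 < \<kappa>" "\<kappa> \<le> 1 / 4" and A: "0 \<notin> A"
  shows "\<exists>f. (\<forall>n\<in>A. mean f (\<theta> * 2 ^ n) = \<kappa>) \<and>
    (\<forall>x\<ge>1. (\<forall>n\<in>A. \<kappa> * (\<theta> * 2 ^ n) \<le> \<bar>x - \<theta> * 2 ^ n\<bar>) \<longrightarrow> mean f x = 0)"
proof -
  define b where "b n = \<theta> * 2 ^ n" for n :: nat
  define e where "e n t = indicat_real {b n - \<kappa> * b n<..b n} t - indicat_real {b n<..b n + \<kappa> * b n} t" for n t
  define u where "u n t = (if n \<in> A then e n t else 0)" for n t
  define f where "f t = (\<Sum>n. u n t)" for t
  have b_pos: "0 < b n" for n using \<theta> by (simp add: b_def)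
  have b_mono: "2 * b m \<le> b n" if "m < n" for m n
  proof -
    have "b (Suc m) \<le> b n" unfolding b_def using that \<theta> by (intro mult_left_mono power_increasing) auto
    then show ?thesis by (simp add: b_def)
  qed
  have b_kappa: "\<kappa> * b n \<le> b n / 4" for n using \<kappa> b_pos[of n] by (simp add: mult_right_mono)
  have kb_pos: "0 < \<kappa> * b n" for n using \<kappa> b_pos[of n] by simp
  \<comment> \<open>Excluding \<open>0\<close> from \<open>A\<close> gives
    \<open>b n \<ge> 2\<close>, so every tent begins to the right of \<open>1\<close>.\<close>
  have b_ge: "2 \<le> b n" if "n \<in> A" for n
  proof -
    have "0 < n" using that A by (cases n) auto
    then have "2 * b 0 \<le> b n" by (rule b_mono)
    moreover have "b 0 = \<theta>" by (simp add: b_def)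
    ultimately show ?thesis using \<theta> by linarith
  qed
  have a_ge: "1 \<le> b n - \<kappa> * b n" if "n \<in> A" for n
    using b_ge[OF that] b_kappa[of n] by linarith
  \<comment> \<open>With \<kappa> at most \<open>1 / 4\<close>, a tent lies between
    \<open>3 / 4\<close> and \<open>5 / 4\<close> of its centre. Centres at least double and
    \<open>5 / 4 < 2 * (3 / 4)\<close>, so the supports are disjoint.\<close>
  have e_supp: "3 / 4 * b n < t \<and> t \<le> 5 / 4 * b n" if "e n t \<noteq> 0" for n t
  proof -
    have "b n - \<kappa> * b n < t \<and> t \<le> b n + \<kappa> * b n"
    proof (rule ccontr)
      assume "\<not> ?thesis"
      then have "t \<notin> {b n - \<kappa> * b n<..b n}" "t \<notin> {b n<..b n + \<kappa> * b n}"
        using kb_pos[of n] by auto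
      with that show False by (simp add: e_def)
    qed
    then show ?thesis using b_kappa[of n] by linarith
  qed
  have disj: "m = n" if "e m t \<noteq> 0" "e n t \<noteq> 0" for m n t
  proof (rule ccontr)
    assume "m \<noteq> n"
    then consider "m < n" | "n < m" by linarith
    then show False
      using e_supp[OF that(1)] e_supp[OF that(2)] b_mono[of m n] b_mono[of n m] b_pos[of m] b_pos[of n]
      by cases auto
  qed
  have f_bound: "\<bar>f t\<bar> \<le> 1" for t
  proof (cases "\<exists>m. u m t \<noteq> 0")
    case True
    then obtain m where "u m t \<noteq> 0" by blast
    then have "f t = (\<Sum>n\<in>{m}. u n t)"
      unfolding f_def using disj by (intro suminf_finite) (auto simp: u_def split: if_splits)
    then show ?thesis by (auto simp: u_def e_def indicator_def)
  qed (simp add: f_def)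
  have ind: "indicat_real {r<..s} \<in> borel_measurable lebesgue" for r s :: real
    by (intro borel_measurable_indicator) simp
  have u_measurable: "u n \<in> borel_measurable lebesgue" for n
    unfolding u_def e_def by (cases "n \<in> A") (simp_all add: borel_measurable_diff[OF ind ind])
  have "f \<in> borel_measurable lebesgue"
    unfolding f_def by (intro borel_measurable_suminf u_measurable)
  then have f: "bounded_fun 1 f" using f_bound by (simp add: bounded_fun_def)
  have int_e: "integral {1..x} (u n) =
      measure lebesgue ({b n - \<kappa> * b n<..b n} \<inter> {1..x}) - measure lebesgue ({b n<..b n + \<kappa> * b n} \<inter> {1..x})"
    if "n \<in> A" for n x
  proof -
    have lm: "{r<..s} \<inter> {1..x} \<in> lmeasurable" for r s :: real
      by (rule bounded_set_imp_lmeasurable) (auto intro: bounded_subset[OF bounded_closed_interval])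
    have "integral {1..x} (u n) = integral {1..x} (indicator {b n - \<kappa> * b n<..b n}) -
        integral {1..x} (indicator {b n<..b n + \<kappa> * b n})"
      unfolding u_def e_def using that
      by (simp, intro Henstock_Kurzweil_Integration.integral_diff
          bounded_fun_integrable[of 1]) (auto simp: bounded_fun_def ind)
    then show ?thesis by (simp add: integral_indicator[OF lm])
  qed
  \<comment> \<open>The condition puts the tents from \<open>N\<close> on to the right of
    \<open>x\<close>, so only finitely many contribute.\<close>
  have int_f: "integral {1..x} f = (\<Sum>n<N. integral {1..x} (u n))" if N: "\<And>n. N \<le> n \<Longrightarrow> 4 / 3 * x \<le> b n" for x N
  proof -
    have "integral {1..x} f = integral {1..x} (\<lambda>t. \<Sum>n<N. u n t)"
    proof (rule Henstock_Kurzweil_Integration.integral_cong)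
      fix t assume t: "t \<in> {1..x}"
      have "u n t = 0" if "n \<notin> {..<N}" for n
        using e_supp[of n t] N[of n] that t by (auto simp: u_def)
      then show "f t = (\<Sum>n<N. u n t)" unfolding f_def by (intro suminf_finite) auto
    qed
    also have "\<dots> = (\<Sum>n<N. integral {1..x} (u n))"
    proof (rule Henstock_Kurzweil_Integration.integral_sum)
      show "u n integrable_on {1..x}" for n
        using u_measurable
        by (intro bounded_fun_integrable[of 1]) (auto simp: bounded_fun_def u_def e_def indicator_def)
    qed simp
    finally show ?thesis .
  qed
  have ex_N: "\<exists>N. \<forall>n\<ge>N. 4 / 3 * x \<le> b n" for x
  proof -
    obtain N where N: "4 / 3 * x < 2 ^ N" using real_arch_pow[of 2 "4 / 3 * x"] by auto
    have "4 / 3 * x \<le> b n" if "n \<ge> N" for n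
    proof -
      have "(2::real) ^ N \<le> 2 ^ n" using that by (intro power_increasing) auto
      also have "\<dots> \<le> b n" using \<theta> by (simp add: b_def)
      finally show ?thesis using N by simp
    qed
    then show ?thesis by blast
  qed
  \<comment> \<open>At this distance from its centre a tent has either not begun or its two halves
    have cancelled.\<close>
  have u_zero: "integral {1..x} (u n) = 0" if gap: "n \<in> A \<Longrightarrow> \<kappa> * b n \<le> \<bar>x - b n\<bar>" for n x
  proof (cases "n \<in> A")
    case True
    then consider "x \<le> b n - \<kappa> * b n" | "b n + \<kappa> * b n \<le> x" using gap[OF True] by linarith
    then show ?thesis
    proof cases
      case 1
      then have "{b n - \<kappa> * b n<..b n} \<inter> {1..x} = {}" "{b n<..b n + \<kappa> * b n} \<inter> {1..x} = {}"
        using kb_pos[of n] by auto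
      then show ?thesis by (simp add: int_e[OF True])
    next
      case 2
      then have "{b n - \<kappa> * b n<..b n} \<inter> {1..x} = {b n - \<kappa> * b n<..b n}"
        "{b n<..b n + \<kappa> * b n} \<inter> {1..x} = {b n<..b n + \<kappa> * b n}"
        using kb_pos[of n] a_ge[OF True] by auto
      then show ?thesis using kb_pos[of n] by (simp add: int_e[OF True])
    qed
  next
    case False
    then have "u n = (\<lambda>_. 0)" by (simp add: u_def fun_eq_iff)
    then show ?thesis by simp
  qed
  show ?thesis
  proof (intro exI[of _ "abs_Linf f"] conjI ballI allI impI)
    fix x :: real assume x: "1 \<le> x" "\<forall>n\<in>A. \<kappa> * (\<theta> * 2 ^ n) \<le> \<bar>x - \<theta> * 2 ^ n\<bar>"
    obtain N where "\<forall>n\<ge>N. 4 / 3 * x \<le> b n" using ex_N by blast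
    then have "integral {1..x} f = (\<Sum>n<N. integral {1..x} (u n))" by (intro int_f) auto
    also have "\<dots> = 0" using x(2) by (intro sum.neutral ballI u_zero) (auto simp: b_def)
    finally show "mean (abs_Linf f) x = 0" by (simp add: mean_abs[OF f])
  next
    fix m assume m: "m \<in> A"
    obtain N where "\<forall>n\<ge>N. 4 / 3 * b m \<le> b n" using ex_N by blast
    then have N: "\<forall>n\<ge>max N (Suc m). 4 / 3 * b m \<le> b n" by auto
    then have "integral {1..b m} f = (\<Sum>n<max N (Suc m). integral {1..b m} (u n))" by (intro int_f) auto
    also have "\<dots> = (\<Sum>n\<in>{m}. integral {1..b m} (u n))"
    proof (rule sum.mono_neutral_right)
      show "\<forall>n\<in>{..<max N (Suc m)} - {m}. integral {1..b m} (u n) = 0"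
      proof (intro ballI u_zero)
        fix n assume "n \<in> {..<max N (Suc m)} - {m}"
        then consider "m < n" | "n < m" by fastforce
        then show "\<kappa> * b n \<le> \<bar>b m - b n\<bar>"
        proof cases
          case 1
          then show ?thesis using b_mono[OF 1] b_kappa[of n] b_pos[of m] b_pos[of n] by linarith
        next
          case 2
          then show ?thesis using b_mono[OF 2] b_kappa[of n] b_pos[of m] b_pos[of n] by linarith
        qed
      qed
    qed auto
    \<comment> \<open>At the centre only the rising half has been integrated.\<close>
    also have "\<dots> = \<kappa> * b m"
    proof -
      have "{b m - \<kappa> * b m<..b m} \<inter> {1..b m} = {b m - \<kappa> * b m<..b m}"
        "{b m<..b m + \<kappa> * b m} \<inter> {1..b m} = {}"
        using a_ge[OF m] by auto
      then show ?thesis using kb_pos[of m] by (simp add: int_e[OF m])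
    qed
    finally show "mean (abs_Linf f) (\<theta> * 2 ^ m) = \<kappa>"
      using b_pos[of m] \<theta> by (simp add: mean_abs[OF f] b_def)
  qed
qed

section \<open>The representation of mean functionals\<close>

lemma one_le_dyadic: "0 \<le> t \<Longrightarrow> 1 \<le> 2 powr t * (2::real) ^ n"
  using mult_mono[of 1 "2 powr t" 1 "2 ^ n"] by (simp add: ge_one_powr_ge_zero)

lemma psi_tendsto:
  assumes "0 \<le> t" "t \<le> 1"
  shows "((\<lambda>n. mean f (2 powr t * 2 ^ n)) \<longlongrightarrow> psi (abs_Omega (\<eta>, t)) f) (filter_of \<eta>)"
proof -
  obtain C where "\<forall>x\<ge>1. \<bar>mean f x\<bar> \<le> C" using mean_bounded by blast
  then show ?thesis
    unfolding psi_abs[OF assms] using one_le_dyadic[OF assms(1)] by (intro ultra_limit) blast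
qed

lemma psi_eqI:
  assumes "0 \<le> t" "t \<le> 1" "((\<lambda>n. mean f (2 powr t * 2 ^ n)) \<longlongrightarrow> l) (filter_of \<eta>)"
  shows "psi (abs_Omega (\<eta>, t)) f = l"
  using psi_tendsto[OF assms(1,2)] assms(3) filter_of_neq_bot tendsto_unique by blast

lemma psi_add:
  assumes "\<omega> \<in> Omega_star" shows "psi \<omega> (f + g) = psi \<omega> f + psi \<omega> g"
  using assms
proof (cases rule: Omega_star_cases)
  case (1 \<eta> t)
  then show ?thesis
    unfolding 1(1) by (intro psi_eqI) (auto simp: mean_add intro!: tendsto_add psi_tendsto)
qed

lemma psi_scaleR:
  assumes "\<omega> \<in> Omega_star" shows "psi \<omega> (c *\<^sub>R f) = c * psi \<omega> f"
  using assms
proof (cases rule: Omega_star_cases)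
  case (1 \<eta> t)
  then show ?thesis
    unfolding 1(1) by (intro psi_eqI) (auto simp: mean_scaleR intro!: tendsto_mult_left psi_tendsto)
qed

lemma psi_max: "\<exists>h. \<forall>\<omega>\<in>Omega_star. psi \<omega> h = max (psi \<omega> f) (psi \<omega> g)"
proof -
  obtain h where h: "\<forall>x\<ge>1. mean h x = max (mean f x) (mean g x)" using mean_max by blast
  have "psi \<omega> h = max (psi \<omega> f) (psi \<omega> g)" if "\<omega> \<in> Omega_star" for \<omega>
    using that
  proof (cases rule: Omega_star_cases)
    case (1 \<eta> t)
    have "(\<lambda>n. mean h (2 powr t * 2 ^ n)) =
        (\<lambda>n. max (mean f (2 powr t * 2 ^ n)) (mean g (2 powr t * 2 ^ n)))"
      by (rule ext) (use h one_le_dyadic[OF 1(3)] in simp)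
    then show ?thesis
      unfolding 1(1) using 1 by (intro psi_eqI) (auto intro!: tendsto_max psi_tendsto)
  qed
  then show ?thesis by blast
qed

text \<open>The integral starts at \<open>1\<close>, so the constant function has mean
  \<open>1 - 1 / x\<close>; the defect disappears because the ultrafilter is free.\<close>

lemma psi_unit: "\<exists>e. \<forall>\<omega>\<in>Omega_star. psi \<omega> e = 1"
proof -
  obtain e where e: "\<forall>x\<ge>1. mean e x = (x - 1) / x" using mean_unit by blast
  have "psi \<omega> e = 1" if "\<omega> \<in> Omega_star" for \<omega>
    using that
  proof (cases rule: Omega_star_cases)
    case (1 \<eta> t)
    have "((\<lambda>n. inverse (2 powr t) * (1 / 2 :: real) ^ n) \<longlongrightarrow> inverse (2 powr t) * 0) sequentially"
      by (intro tendsto_mult tendsto_const LIMSEQ_power_zero) simp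
    then have "((\<lambda>n. inverse (2 powr t * (2::real) ^ n)) \<longlongrightarrow> 0) sequentially"
      by (simp add: power_one_over inverse_eq_divide)
    then have "((\<lambda>n. 1 - inverse (2 powr t * (2::real) ^ n)) \<longlongrightarrow> 1 - 0) sequentially"
      by (intro tendsto_diff tendsto_const)
    then have "((\<lambda>n. 1 - inverse (2 powr t * (2::real) ^ n)) \<longlongrightarrow> 1) (filter_of \<eta>)"
      using 1(2) by (auto simp: free_ultrafilters_iff intro: tendsto_mono)
    moreover have "(\<lambda>n. mean e (2 powr t * 2 ^ n)) = (\<lambda>n. 1 - inverse (2 powr t * 2 ^ n))"
      using e one_le_dyadic[OF 1(3)] by (auto simp: diff_divide_distrib inverse_eq_divide)
    ultimately show ?thesis
      unfolding 1(1) using 1 by (intro psi_eqI) auto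
  qed
  then show ?thesis by blast
qed

section \<open>Continuity of the functions on the torus\<close>

lemma mean_dyadic_Lipschitz:
  obtains C where "C \<ge> 0" "\<And>s t n. 0 \<le> s \<Longrightarrow> 0 \<le> t \<Longrightarrow>
    \<bar>mean f (2 powr s * 2 ^ n) - mean f (2 powr t * 2 ^ n)\<bar> \<le> C * (2 powr \<bar>s - t\<bar> - 1)"
proof -
  obtain C where C: "C \<ge> 0" "\<forall>x y. 1 \<le> x \<longrightarrow> x \<le> y \<longrightarrow> \<bar>mean f y - mean f x\<bar> \<le> C * (y / x - 1)"
    using mean_Lipschitz by blast
  have le: "\<bar>mean f (2 powr s * 2 ^ n) - mean f (2 powr t * 2 ^ n)\<bar> \<le> C * (2 powr (s - t) - 1)"
    if "0 \<le> t" "t \<le> s" for s t n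
  proof -
    have "2 powr t * (2::real) ^ n \<le> 2 powr s * 2 ^ n" using that by (intro mult_right_mono) auto
    moreover have "(2 powr s * 2 ^ n) / (2 powr t * (2::real) ^ n) = 2 powr (s - t)"
      by (simp add: powr_diff)
    ultimately show ?thesis using C(2) one_le_dyadic[OF that(1), of n] by metis
  qed
  show ?thesis
  proof (rule that[OF C(1)])
    fix s t :: real and n assume "0 \<le> s" "0 \<le> t"
    then show "\<bar>mean f (2 powr s * 2 ^ n) - mean f (2 powr t * 2 ^ n)\<bar> \<le> C * (2 powr \<bar>s - t\<bar> - 1)"
      using le[of t s n] le[of s t n] by (cases "t \<le> s") (auto simp: abs_minus_commute)
  qed
qed

lemma dyadic_modulus_tendsto: "((\<lambda>t. C * (2 powr \<bar>t - s\<bar> - 1)) \<longlongrightarrow> 0) (nhds (s::real))"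
proof -
  have "isCont (\<lambda>t. C * (2 powr \<bar>t - s\<bar> - 1)) s"
    by (intro continuous_intros) auto
  then have "((\<lambda>t. C * (2 powr \<bar>t - s\<bar> - 1)) \<longlongrightarrow> C * (2 powr \<bar>s - s\<bar> - 1)) (nhds s)"
    unfolding isCont_def by (rule tendsto_at_iff_tendsto_nhds[THEN iffD1])
  then show ?thesis by simp
qed

text \<open>The modulus in \<open>t\<close> does not depend on \<open>n\<close>, so the coordinates
  separate: \<open>A\<close> controls the means at the fixed \<open>t\<close>, and \<open>S\<close>
  controls the change of the real coordinate. Continuity on the cylinder then passes to the
  quotient.\<close>

lemma continuous_on_psi: "continuous_on Omega_star (\<lambda>\<omega>. psi \<omega> f)"
proof -
  obtain C where C: "C \<ge> 0" "\<And>s t n. 0 \<le> s \<Longrightarrow> 0 \<le> t \<Longrightarrow>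
    \<bar>mean f (2 powr s * 2 ^ n) - mean f (2 powr t * 2 ^ n)\<bar> \<le> C * (2 powr \<bar>s - t\<bar> - 1)"
    using mean_dyadic_Lipschitz by blast
  have cyl: "continuous_on cylinder (\<lambda>p. psi (abs_Omega p) f)"
    unfolding continuous_on_topological
  proof (intro ballI allI impI)
    fix p and B :: "real set"
    assume p: "p \<in> cylinder" and B: "open B" "psi (abs_Omega p) f \<in> B"
    obtain \<eta> t where pt: "p = (\<eta>, t)" "0 \<le> t" "t \<le> 1" using p by auto
    define l where "l = psi (abs_Omega p) f"
    obtain \<epsilon> where \<epsilon>: "\<epsilon> > 0" "ball l \<epsilon> \<subseteq> B"
      using B open_contains_ball unfolding l_def by blast
    define A where "A = {n. \<bar>mean f (2 powr t * 2 ^ n) - l\<bar> < \<epsilon> / 3}"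
    have "((\<lambda>n. mean f (2 powr t * 2 ^ n)) \<longlongrightarrow> l) (filter_of \<eta>)"
      unfolding l_def pt(1) by (rule psi_tendsto[OF pt(2,3)])
    then have A: "eventually (\<lambda>n. n \<in> A) (filter_of \<eta>)"
      using tendstoD[of _ l _ "\<epsilon> / 3"] \<epsilon>(1) unfolding A_def mem_Collect_eq dist_real_def by simp
    have "eventually (\<lambda>s. C * (2 powr \<bar>s - t\<bar> - 1) < \<epsilon> / 3) (nhds t)"
      using dyadic_modulus_tendsto[of C t] \<epsilon>(1) by (intro order_tendstoD(2)) auto
    then obtain S where S: "open S" "t \<in> S" "\<And>s. s \<in> S \<Longrightarrow> C * (2 powr \<bar>s - t\<bar> - 1) < \<epsilon> / 3"
      unfolding eventually_nhds by blast
    define N where "N = {\<zeta>. eventually (\<lambda>n. n \<in> A) (filter_of \<zeta>)}"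
    have "open N" unfolding N_def open_betaN_def by (rule generate_topology.Basis) blast
    have "psi (abs_Omega q) f \<in> B" if q: "q \<in> cylinder" "q \<in> N \<times> S" for q
    proof -
      obtain \<zeta> s where qs: "q = (\<zeta>, s)" "0 \<le> s" "s \<le> 1" "\<zeta> \<in> N" "s \<in> S" using q by auto
      \<comment> \<open>Limits preserve only weak inequalities, so \<open>2 * \<epsilon> / 3\<close>
        leaves room below \<epsilon>.\<close>
      have ev: "eventually (\<lambda>n. \<bar>mean f (2 powr s * 2 ^ n) - l\<bar> \<le> 2 * \<epsilon> / 3) (filter_of \<zeta>)"
        using qs(4) unfolding N_def mem_Collect_eq
      proof eventually_elim
        case (elim n)
        then have "\<bar>mean f (2 powr t * 2 ^ n) - l\<bar> < \<epsilon> / 3" by (simp add: A_def)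
        then show ?case using C(2)[OF qs(2) pt(2), of n] S(3)[OF qs(5)] by linarith
      qed
      have "((\<lambda>n. \<bar>mean f (2 powr s * 2 ^ n) - l\<bar>) \<longlongrightarrow> \<bar>psi (abs_Omega q) f - l\<bar>) (filter_of \<zeta>)"
        unfolding qs(1) by (intro tendsto_intros psi_tendsto qs)
      from tendsto_upperbound[OF this ev filter_of_neq_bot]
      have "\<bar>psi (abs_Omega q) f - l\<bar> < \<epsilon>" using \<epsilon>(1) by simp
      then show ?thesis using \<epsilon>(2) by (auto simp: dist_real_def abs_minus_commute)
    qed
    then show "\<exists>A. open A \<and> p \<in> A \<and> (\<forall>y\<in>cylinder. y \<in> A \<longrightarrow> psi (abs_Omega y) f \<in> B)"
      using \<open>open N\<close> S A pt(1) by (intro exI[of _ "N \<times> S"]) (auto simp: N_def open_Times)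
  qed
  have "open ((\<lambda>\<omega>. psi \<omega> f) -` B)" if "open B" for B
  proof -
    have "{p \<in> cylinder. abs_Omega p \<in> (\<lambda>\<omega>. psi \<omega> f) -` B} = cylinder \<inter> (\<lambda>p. psi (abs_Omega p) f) -` B"
      by auto
    then show ?thesis
      unfolding open_Omega_def using continuous_openin_preimage_gen[OF cyl that] by simp
  qed
  then have "continuous_on UNIV (\<lambda>\<omega>. psi \<omega> f)" by (simp add: continuous_on_open_vimage)
  then show ?thesis by (rule continuous_on_subset) simp
qed

section \<open>Neighbourhoods and bump functions\<close>

lemma Omega_open_nhd:
  assumes W: "open W" and \<eta>: "abs_Omega (\<eta>, t) \<in> W" "0 \<le> t" "t \<le> 1"
  obtains A \<delta> where "eventually (\<lambda>n. n \<in> A) (filter_of \<eta>)" "\<delta> > 0"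
    "\<And>\<zeta> s. eventually (\<lambda>n. n \<in> A) (filter_of \<zeta>) \<Longrightarrow> 0 \<le> s \<Longrightarrow> s \<le> 1 \<Longrightarrow> \<bar>s - t\<bar> < \<delta> \<Longrightarrow>
      abs_Omega (\<zeta>, s) \<in> W"
proof -
  obtain T where T: "open T" "{p \<in> cylinder. abs_Omega p \<in> W} = cylinder \<inter> T"
    using W unfolding open_Omega_def openin_open by blast
  have "(\<eta>, t) \<in> {p \<in> cylinder. abs_Omega p \<in> W}" using \<eta> by simp
  then have "(\<eta>, t) \<in> T" unfolding T(2) by simp
  with T(1) obtain N S where NS: "open N" "open S" "(\<eta>, t) \<in> N \<times> S" "N \<times> S \<subseteq> T"
    by (rule open_prod_elim)
  then have N: "open N" "open S" "\<eta> \<in> N" "t \<in> S" by auto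
  obtain A where A: "eventually (\<lambda>n. n \<in> A) (filter_of \<eta>)" "{\<zeta>. eventually (\<lambda>n. n \<in> A) (filter_of \<zeta>)} \<subseteq> N"
    using N(1,3) unfolding open_betaN_iff by blast
  obtain \<delta> where \<delta>: "\<delta> > 0" "ball t \<delta> \<subseteq> S" using N(2,4) open_contains_ball by blast
  show ?thesis
  proof (rule that[OF A(1) \<delta>(1)])
    fix \<zeta> s assume "eventually (\<lambda>n. n \<in> A) (filter_of \<zeta>)" "0 \<le> s" "s \<le> 1" "\<bar>s - t\<bar> < \<delta>"
    then have "\<zeta> \<in> N" "s \<in> ball t \<delta>"
      using A(2) by (auto simp: dist_real_def abs_minus_commute)
    then have "(\<zeta>, s) \<in> T" using NS(4) \<delta>(2) by blast
    then have "(\<zeta>, s) \<in> cylinder \<inter> T" using \<open>0 \<le> s\<close> \<open>s \<le> 1\<close> by simp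
    then show "abs_Omega (\<zeta>, s) \<in> W" unfolding T(2)[symmetric] by simp
  qed
qed

text \<open>In the coordinate \<open>n + t\<close>, i.e. \<open>log 2 x\<close>, a neighbourhood of \<open>(\<eta>, t)\<close> is given by the points
  within \<open>\<delta>\<close> of \<open>A + t\<close>; for \<open>t = 0\<close> it has to cover both sides of the gluing.\<close>

lemma Omega_star_nhd:
  assumes W: "open W" and \<eta>: "abs_Omega (\<eta>, t) \<in> W" "\<eta> \<in> free_ultrafilters" "0 \<le> t" "t < 1"
  obtains A \<delta> where "eventually (\<lambda>n. n \<in> A) (filter_of \<eta>)" "0 \<notin> A" "\<delta> > 0"
    "\<And>\<zeta> s. eventually (\<lambda>n. \<exists>m\<in>A. \<bar>(real n + s) - (real m + t)\<bar> < \<delta>) (filter_of \<zeta>) \<Longrightarrow>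
      0 \<le> s \<Longrightarrow> s < 1 \<Longrightarrow> abs_Omega (\<zeta>, s) \<in> W"
proof -
  obtain A0 \<delta>0 where A0: "eventually (\<lambda>n. n \<in> A0) (filter_of \<eta>)" "\<delta>0 > 0"
    "\<And>\<zeta> s. eventually (\<lambda>n. n \<in> A0) (filter_of \<zeta>) \<Longrightarrow> 0 \<le> s \<Longrightarrow> s \<le> 1 \<Longrightarrow> \<bar>s - t\<bar> < \<delta>0 \<Longrightarrow>
      abs_Omega (\<zeta>, s) \<in> W"
    using Omega_open_nhd[OF W \<eta>(1,3) less_imp_le[OF \<eta>(4)]] by blast
  have pos: "eventually (\<lambda>n. 0 < n) (filter_of \<eta>)"
    using \<eta>(2) eventually_gt_at_top[of "0::nat"] by (simp add: free_ultrafilters_iff le_filter_def)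
  show ?thesis
  proof (cases "t = 0")
    case False
    \<comment> \<open>\<delta> is at most the distance from \<open>t\<close> to either end of the
      unit interval, so closeness of \<open>n + s\<close> and \<open>m + t\<close> forces
      \<open>n = m\<close>.\<close>
    define \<delta> where "\<delta> = min \<delta>0 (min t (1 - t))"
    have \<delta>: "\<delta> > 0" "\<delta> \<le> \<delta>0" "\<delta> \<le> t" "\<delta> \<le> 1 - t" using A0(2) False \<eta> by (auto simp: \<delta>_def)
    show ?thesis
    proof (rule that[of "A0 - {0}" \<delta>])
      show "eventually (\<lambda>n. n \<in> A0 - {0}) (filter_of \<eta>)"
        using A0(1) pos by eventually_elim simp
      fix \<zeta> s
      assume ev: "eventually (\<lambda>n. \<exists>m\<in>A0 - {0}. \<bar>(real n + s) - (real m + t)\<bar> < \<delta>) (filter_of \<zeta>)"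
        and s: "0 \<le> s" "s < 1"
      have near: "n = m \<and> \<bar>s - t\<bar> < \<delta>" if "\<bar>(real n + s) - (real m + t)\<bar> < \<delta>" for n m
      proof -
        have "real n < real m + 1" "real m < real n + 1" using that s \<delta> by linarith+
        then have "n = m" by linarith
        then show ?thesis using that by simp
      qed
      have "eventually (\<lambda>n. n \<in> A0 \<and> \<bar>s - t\<bar> < \<delta>) (filter_of \<zeta>)"
        using ev by eventually_elim (use near in blast)
      then have "eventually (\<lambda>n. n \<in> A0) (filter_of \<zeta>)" "\<bar>s - t\<bar> < \<delta>"
        by (auto simp: eventually_conj_iff)
      then show "abs_Omega (\<zeta>, s) \<in> W" using A0(3) s \<delta> by simp
    qed (use \<delta> in auto)
  next
    case True
    \<comment> \<open>The class of \<open>(\<eta>, 0)\<close> is also that of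
      \<open>(\<xi>, 1)\<close>, whose neighbourhoods describe the side just below an
      integer.\<close>
    obtain \<xi> where \<xi>: "\<xi> \<in> free_ultrafilters" "tau \<xi> = \<eta>" using tau_surj_free[OF \<eta>(2)] by blast
    have "abs_Omega (\<xi>, 1) \<in> W" using \<eta>(1) True by (simp add: abs_Omega_glue \<xi>(2))
    then obtain A1 \<delta>1 where A1: "eventually (\<lambda>n. n \<in> A1) (filter_of \<xi>)" "\<delta>1 > 0"
      "\<And>\<zeta> s. eventually (\<lambda>n. n \<in> A1) (filter_of \<zeta>) \<Longrightarrow> 0 \<le> s \<Longrightarrow> s \<le> 1 \<Longrightarrow> \<bar>s - 1\<bar> < \<delta>1 \<Longrightarrow>
        abs_Omega (\<zeta>, s) \<in> W"
      using Omega_open_nhd[OF W, of \<xi> 1] by auto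
    define A where "A = {m \<in> A0. 0 < m \<and> m - 1 \<in> A1}"
    \<comment> \<open>With \<delta> at most \<open>1 / 2\<close>, a match means \<open>m = n\<close>
      when \<open>s < 1 / 2\<close> and \<open>m = n + 1\<close> otherwise; the second case is why
      \<open>A\<close> asks for \<open>m - 1 \<in> A1\<close>.\<close>
    define \<delta> where "\<delta> = min (min \<delta>0 \<delta>1) (1 / 2)"
    have \<delta>: "\<delta> > 0" "\<delta> \<le> \<delta>0" "\<delta> \<le> \<delta>1" "\<delta> \<le> 1 / 2" using A0(2) A1(2) by (auto simp: \<delta>_def)
    show ?thesis
    proof (rule that[of A \<delta>])
      have "eventually (\<lambda>n. n - 1 \<in> A1) (filter_of \<eta>)"
        using A1(1) unfolding \<xi>(2)[symmetric] by (simp add: tau.rep_eq eventually_filtermap)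
      then show "eventually (\<lambda>n. n \<in> A) (filter_of \<eta>)"
        using A0(1) pos by eventually_elim (simp add: A_def)
      show "0 \<notin> A" by (simp add: A_def)
      fix \<zeta> s
      assume ev: "eventually (\<lambda>n. \<exists>m\<in>A. \<bar>(real n + s) - (real m + t)\<bar> < \<delta>) (filter_of \<zeta>)"
        and s: "0 \<le> s" "s < 1"
      show "abs_Omega (\<zeta>, s) \<in> W"
      proof (cases "s < 1 / 2")
        case s2: True
        have near: "n = m \<and> \<bar>s - t\<bar> < \<delta>" if "\<bar>(real n + s) - (real m + t)\<bar> < \<delta>" for n m
        proof -
          have "real n < real m + 1" "real m < real n + 1" using that s s2 True \<delta> by linarith+
          then have "n = m" by linarith
          then show ?thesis using that by simp
        qed
        have "eventually (\<lambda>n. n \<in> A0 \<and> \<bar>s - t\<bar> < \<delta>) (filter_of \<zeta>)"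
          using ev by eventually_elim (use near in \<open>auto simp: A_def\<close>)
        then have "eventually (\<lambda>n. n \<in> A0) (filter_of \<zeta>)" "\<bar>s - t\<bar> < \<delta>"
          by (auto simp: eventually_conj_iff)
        then show ?thesis using A0(3) s \<delta> by simp
      next
        case s2: False
        have near: "m = Suc n \<and> \<bar>s - 1\<bar> < \<delta>" if "\<bar>(real n + s) - (real m + t)\<bar> < \<delta>" for n m
        proof -
          have "real n < real m" "real m < real n + 2" using that s s2 True \<delta> by linarith+
          then have "m = Suc n" by linarith
          then show ?thesis using that True by simp
        qed
        have "eventually (\<lambda>n. n \<in> A1 \<and> \<bar>s - 1\<bar> < \<delta>) (filter_of \<zeta>)"
          using ev by eventually_elim (use near in \<open>fastforce simp: A_def\<close>)
        then have "eventually (\<lambda>n. n \<in> A1) (filter_of \<zeta>)" "\<bar>s - 1\<bar> < \<delta>"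
          by (auto simp: eventually_conj_iff)
        then show ?thesis using A1(3) s \<delta> by simp
      qed
    qed (rule \<delta>)
  qed
qed

text \<open>The critical case is \<open>d = - \<delta>\<close>: for
  \<open>a = 2 powr \<delta>\<close>, the inequality \<open>1 - 1 / a \<le> a - 1\<close> comes from
  \<open>0 \<le> (a - 1) ^ 2\<close>.\<close>

lemma dyadic_separation:
  fixes d \<delta> :: real
  assumes "\<delta> > 0" "\<delta> \<le> \<bar>d\<bar>"
  shows "1 - 2 powr (- \<delta>) \<le> \<bar>2 powr d - 1\<bar>"
proof (cases "0 \<le> d")
  case True
  define a where "a = (2::real) powr \<delta>"
  have a: "1 \<le> a" unfolding a_def using assms by (intro ge_one_powr_ge_zero) auto
  have "a * (2 - a) \<le> 1" using zero_le_power2[of "a - 1"] by (simp add: power2_eq_square algebra_simps)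
  then have "1 - 1 / a \<le> a - 1" using a by (simp add: field_simps)
  also have "a \<le> 2 powr d" unfolding a_def using assms True by (intro powr_mono) auto
  finally show ?thesis by (simp add: a_def powr_minus_divide)
next
  case False
  then have "2 powr d \<le> 2 powr (- \<delta>)" using assms by (intro powr_mono) auto
  then show ?thesis by linarith
qed

lemma psi_bump:
  assumes U: "openin (top_of_set Omega_star) U" and \<omega>: "\<omega> \<in> U"
  shows "\<exists>g. psi \<omega> g = 1 \<and> (\<forall>\<xi>\<in>Omega_star. 0 \<le> psi \<xi> g \<and> psi \<xi> g \<le> 1) \<and>
    (\<forall>\<xi>\<in>Omega_star - U. psi \<xi> g = 0)"
proof -
  obtain W where W: "open W" "U = Omega_star \<inter> W" using U unfolding openin_open by blast
  have "\<omega> \<in> Omega_star" using \<omega> W by blast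
  then obtain \<eta> t where \<eta>: "\<omega> = abs_Omega (\<eta>, t)" "\<eta> \<in> free_ultrafilters" "0 \<le> t" "t < 1"
    by (rule Omega_star_cases)
  have in_W: "abs_Omega (\<eta>, t) \<in> W" using \<omega> W \<eta>(1) by blast
  obtain A \<delta> where A: "eventually (\<lambda>n. n \<in> A) (filter_of \<eta>)" "0 \<notin> A" "\<delta> > 0"
    "\<And>\<zeta> s. eventually (\<lambda>n. \<exists>m\<in>A. \<bar>(real n + s) - (real m + t)\<bar> < \<delta>) (filter_of \<zeta>) \<Longrightarrow>
      0 \<le> s \<Longrightarrow> s < 1 \<Longrightarrow> abs_Omega (\<zeta>, s) \<in> W"
    using Omega_star_nhd[OF W(1) in_W \<eta>(2-4)] by blast
  \<comment> \<open>\<open>1 / 4\<close> keeps the tents disjoint;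
    \<open>1 - 2 powr (- \<delta>)\<close> makes the tents vanish at points whose binary logarithm
    differs from that of every centre by at least \<delta>.\<close>
  define \<kappa> where "\<kappa> = min (1 / 4) (1 - 2 powr (- \<delta>))"
  have \<kappa>: "0 < \<kappa>" "\<kappa> \<le> 1 / 4"
    unfolding \<kappa>_def using A(3) powr_less_mono[of "- \<delta>" 0 2] by (simp, intro min.cobounded1)
  have "1 \<le> 2 powr t" using \<eta>(3) by (intro ge_one_powr_ge_zero) auto
  from mean_tents[OF this \<kappa> A(2)] obtain f where f: "\<forall>n\<in>A. mean f (2 powr t * 2 ^ n) = \<kappa>"
    "\<forall>x\<ge>1. (\<forall>n\<in>A. \<kappa> * (2 powr t * 2 ^ n) \<le> \<bar>x - 2 powr t * 2 ^ n\<bar>) \<longrightarrow> mean f x = 0"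
    by blast
  have f1: "psi \<omega> f = \<kappa>"
    unfolding \<eta>(1)
  proof (rule psi_eqI)
    show "((\<lambda>n. mean f (2 powr t * 2 ^ n)) \<longlongrightarrow> \<kappa>) (filter_of \<eta>)"
    proof (rule tendsto_eventually)
      show "eventually (\<lambda>n. mean f (2 powr t * 2 ^ n) = \<kappa>) (filter_of \<eta>)"
        using A(1) by eventually_elim (use f(1) in blast)
    qed
  qed (use \<eta> in auto)
  have f0: "psi \<xi> f = 0" if \<xi>: "\<xi> \<in> Omega_star - U" for \<xi>
  proof -
    obtain \<zeta> s where \<zeta>: "\<xi> = abs_Omega (\<zeta>, s)" "0 \<le> s" "s < 1"
      using \<xi> by (auto elim: Omega_star_cases)
    \<comment> \<open>The ultrafilter turns failure of the neighbourhood condition into its eventual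
      negation, so almost all sample points miss every tent.\<close>
    have "\<not> eventually (\<lambda>n. \<exists>m\<in>A. \<bar>(real n + s) - (real m + t)\<bar> < \<delta>) (filter_of \<zeta>)"
      using A(4) \<zeta> \<xi> W(2) by blast
    then have "eventually (\<lambda>n. \<not> (\<exists>m\<in>A. \<bar>(real n + s) - (real m + t)\<bar> < \<delta>)) (filter_of \<zeta>)"
      by (simp add: ultra_not[OF ultra_filter_of])
    then have "eventually (\<lambda>n. mean f (2 powr s * 2 ^ n) = 0) (filter_of \<zeta>)"
    proof eventually_elim
      case (elim n)
      have "\<kappa> * (2 powr t * 2 ^ m) \<le> \<bar>2 powr s * 2 ^ n - 2 powr t * 2 ^ m\<bar>" if "m \<in> A" for m
      proof -
        define d where "d = (real n + s) - (real m + t)"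
        have "\<delta> \<le> \<bar>d\<bar>" using elim that by (auto simp: d_def not_less)
        then have "\<kappa> \<le> \<bar>2 powr d - 1\<bar>"
          using dyadic_separation[OF A(3)] unfolding \<kappa>_def by (meson min.cobounded2 order_trans)
        then have "\<kappa> * (2 powr t * 2 ^ m) \<le> \<bar>2 powr d - 1\<bar> * (2 powr t * 2 ^ m)"
          by (intro mult_right_mono) auto
        also have "\<dots> = \<bar>(2 powr d - 1) * (2 powr t * 2 ^ m)\<bar>" by (simp add: abs_mult)
        also have "(2 powr d - 1) * (2 powr t * 2 ^ m) = 2 powr s * 2 ^ n - 2 powr t * 2 ^ m"
          by (simp add: d_def powr_diff powr_add powr_realpow left_diff_distrib)
        finally show ?thesis .
      qed
      then show ?case using f(2) one_le_dyadic[OF \<zeta>(2)] by blast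
    qed
    then show ?thesis
      unfolding \<zeta>(1) using \<zeta> by (intro psi_eqI tendsto_eventually) auto
  qed
  obtain e where e: "\<forall>\<omega>\<in>Omega_star. psi \<omega> e = 1" using psi_unit by blast
  \<comment> \<open>Clipping \<open>f / \<kappa>\<close> to \<open>[0, 1]\<close> with maxima only:
    \<open>h\<close> is the positive part of \<open>f\<close>, and \<open>k\<close> is the negative
    of the clipped function, because \<open>min u 1 = - max (- u) (- 1)\<close>.\<close>
  obtain h where h: "\<forall>\<omega>\<in>Omega_star. psi \<omega> h = max (psi \<omega> f) (psi \<omega> (0 *\<^sub>R f))" using psi_max by blast
  obtain k where k: "\<forall>\<omega>\<in>Omega_star. psi \<omega> k = max (psi \<omega> ((- 1 / \<kappa>) *\<^sub>R h)) (psi \<omega> ((- 1) *\<^sub>R e))"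
    using psi_max by blast
  have g: "psi \<xi> ((- 1) *\<^sub>R k) = min (max (psi \<xi> f) 0 / \<kappa>) 1" if "\<xi> \<in> Omega_star" for \<xi>
    using that e h k by (simp only: psi_scaleR) auto
  show ?thesis
  proof (intro exI[of _ "(- 1) *\<^sub>R k"] conjI ballI)
    show "psi \<omega> ((- 1) *\<^sub>R k) = 1" using g[OF \<open>\<omega> \<in> Omega_star\<close>] f1 \<kappa> by simp
    show "psi \<xi> ((- 1) *\<^sub>R k) = 0" if "\<xi> \<in> Omega_star - U" for \<xi>
      using g[of \<xi>] f0[OF that] that by simp
  qed (use g \<kappa> in \<open>simp_all\<close>)
qed

text \<open>Otherwise some ultrafilter \<open>G\<close> at infinity contains the set where the mean
  is too large. The integer part of \<open>log 2 x\<close> pushes \<open>G\<close> to a free \<eta>,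
  the fractional part converges to some \<open>s\<close> along \<open>G\<close>, and
  \<open>psi\<close> at the class of \<open>(\<eta>, s)\<close> would be at least
  \<open>c + \<epsilon>\<close>.\<close>

lemma eventually_mean_le:
  assumes c: "\<And>\<omega>. \<omega> \<in> Omega_star \<Longrightarrow> psi \<omega> f \<le> c" and "0 < \<epsilon>"
  shows "eventually (\<lambda>x. mean f x \<le> c + \<epsilon>) at_top"
proof (rule ccontr)
  assume not: "\<not> ?thesis"
  define F where "F = inf at_top (principal {x. c + \<epsilon> < mean f x})"
  have "F \<noteq> bot"
    using not by (simp add: F_def trivial_limit_def eventually_inf_principal not_less)
  then obtain G where G: "G \<le> F" "ultra G" by (rule ultra_extension)
  have G_top: "G \<le> at_top" and G_gt: "eventually (\<lambda>x. c + \<epsilon> < mean f x) G"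
    using G(1) by (auto simp: F_def le_principal)
  define n where "n x = nat \<lfloor>log 2 x\<rfloor>" for x :: real
  define t where "t x = log 2 x - n x" for x
  define \<eta> where "\<eta> = betaN_of (filtermap n G)"
  have \<eta>: "filter_of \<eta> = filtermap n G"
    unfolding \<eta>_def by (intro filter_of_betaN_of ultra_filtermap G)
  have log2: "filterlim (log 2) at_top at_top"
    unfolding log_def by (intro filterlim_at_top_mult_tendsto_pos[OF tendsto_const _ ln_at_top, of "1 / ln 2", simplified])
  have "filterlim n sequentially at_top"
    unfolding n_def by (intro filterlim_compose[OF filterlim_nat_sequentially]
      filterlim_compose[OF filterlim_floor_sequentially] log2)
  then have "filterlim n sequentially G" using G_top by (rule filterlim_mono[OF _ order_refl])
  then have free: "\<eta> \<in> free_ultrafilters" by (simp add: free_ultrafilters_iff \<eta> filterlim_def)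
  have ge1: "eventually (\<lambda>x. 1 \<le> x) G"
    using G_top eventually_ge_at_top[of "1::real"] by (simp add: le_filter_def)
  have t01: "0 \<le> t x \<and> t x \<le> 1" "x = 2 powr t x * 2 ^ n x" if "1 \<le> x" for x
  proof -
    have "0 \<le> log 2 x" using that by simp
    then have "real (n x) = \<lfloor>log 2 x\<rfloor>" by (simp add: n_def)
    then show "0 \<le> t x \<and> t x \<le> 1" unfolding t_def by linarith
    have "2 powr t x * 2 ^ n x = 2 powr (t x + n x)" by (simp add: powr_add powr_realpow)
    also have "\<dots> = x" using that by (simp add: t_def)
    finally show "x = 2 powr t x * 2 ^ n x" by simp
  qed
  \<comment> \<open>The fractional parts may converge to \<open>1\<close>, hence the closed
    interval.\<close>
  have "eventually (\<lambda>x. t x \<in> {0..1}) G" using ge1 by eventually_elim (use t01 in simp)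
  then obtain s where s: "s \<in> {0..1}" "(t \<longlongrightarrow> s) G"
    using ultra_converges[OF G(2) compact_Icc] by blast
  define \<omega> where "\<omega> = abs_Omega (\<eta>, s)"
  have "\<omega> \<in> Omega_star" using s free by (auto simp: \<omega>_def Omega_star_def)
  obtain C where C: "C \<ge> 0" "\<And>s t n. 0 \<le> s \<Longrightarrow> 0 \<le> t \<Longrightarrow>
    \<bar>mean f (2 powr s * 2 ^ n) - mean f (2 powr t * 2 ^ n)\<bar> \<le> C * (2 powr \<bar>s - t\<bar> - 1)"
    using mean_dyadic_Lipschitz by blast
  have "((\<lambda>k. mean f (2 powr s * 2 ^ k)) \<longlongrightarrow> psi \<omega> f) (filtermap n G)"
    using psi_tendsto[of s f \<eta>] s(1) by (simp add: \<omega>_def \<eta>)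
  then have lim: "((\<lambda>x. mean f (2 powr s * 2 ^ n x)) \<longlongrightarrow> psi \<omega> f) G"
    by (simp add: filterlim_filtermap)
  \<comment> \<open>Replacing \<open>t x\<close> by its limit \<open>s\<close> costs a modulus that
    vanishes along \<open>G\<close>.\<close>
  have "((\<lambda>x. c + \<epsilon> - C * (2 powr \<bar>t x - s\<bar> - 1)) \<longlongrightarrow> c + \<epsilon> - 0) G"
    by (intro tendsto_diff tendsto_const filterlim_compose[OF dyadic_modulus_tendsto s(2)])
  moreover have "eventually (\<lambda>x. c + \<epsilon> - C * (2 powr \<bar>t x - s\<bar> - 1) \<le> mean f (2 powr s * 2 ^ n x)) G"
    using ge1 G_gt
  proof eventually_elim
    case (elim x)
    then show ?case using C(2)[of "t x" s "n x"] t01[of x] s(1) by auto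
  qed
  moreover have "G \<noteq> bot" using G(2) by (simp add: ultra_def)
  ultimately have "c + \<epsilon> - 0 \<le> psi \<omega> f"
    using tendsto_le[OF _ lim] by blast
  with c[OF \<open>\<omega> \<in> Omega_star\<close>] \<open>0 < \<epsilon>\<close> show False by simp
qed

lemma mean_functional_le:
  assumes \<psi>: "\<psi> \<in> mean_functionals" and c: "\<And>\<omega>. \<omega> \<in> Omega_star \<Longrightarrow> psi \<omega> f \<le> c"
  shows "\<psi> f \<le> c"
proof (rule field_le_epsilon)
  fix \<epsilon> :: real assume "0 < \<epsilon>"
  have "ereal (\<psi> f) \<le> Limsup at_top (\<lambda>x. ereal (mean f x))"
    using \<psi> by (simp add: mean_functionals_def)
  also have "\<dots> \<le> ereal (c + \<epsilon>)"
    using eventually_mean_le[OF c \<open>0 < \<epsilon>\<close>] by (intro Limsup_bounded) (simp_all add: eventually_mono)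
  finally show "\<psi> f \<le> c + \<epsilon>" by simp
qed

theorem theorem4p3:
  fixes \<psi> :: "Linf \<Rightarrow> real"
  assumes "\<psi> \<in> mean_functionals"
  shows "\<exists>!\<mu>. regular_Borel_prob Omega_star \<mu> \<and>
           (\<forall>f. \<psi> f = (LINT \<omega>|\<mu>. psi \<omega> f))"
proof -
  obtain e where e: "\<forall>\<omega>\<in>Omega_star. psi \<omega> e = 1" using psi_unit by blast
  have linear: "linear \<psi>" using assms by (simp add: mean_functionals_def)
  have neg: "psi \<omega> (- f) = - psi \<omega> f" if "\<omega> \<in> Omega_star" for \<omega> f
    using psi_scaleR[OF that, of "- 1" f] by simp
  interpret positive_functional Omega_star "\<lambda>f \<omega>. psi \<omega> f" e \<psi>
  proof
    \<comment> \<open>Positivity is the upper bound \<open>0\<close> for \<open>- f\<close>; the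
      bounds for \<open>e\<close> and \<open>- e\<close> below fix the value at
      \<open>e\<close>.\<close>
    show "0 \<le> \<psi> f" if "\<And>\<omega>. \<omega> \<in> Omega_star \<Longrightarrow> 0 \<le> psi \<omega> f" for f
      using mean_functional_le[OF assms, of "- f" 0] that neg linear_neg[OF linear] by simp
    have "\<psi> (- e) \<le> - 1" "\<psi> e \<le> 1"
      using e neg by (auto intro!: mean_functional_le[OF assms])
    then show "\<psi> e = 1" using linear_neg[OF linear] by simp
  qed (use compact_Omega_star psi_add psi_scaleR psi_max e continuous_on_psi psi_bump
      linear_add[OF linear] linear_scale[OF linear] in auto)
  show ?thesis by (rule riesz_representation)
qed

end
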